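(* Let $\rho(\cdot,y)$ be convex for each $y\in\{0,1\}$ and satisfy, for some $L>0$, $|\rho(b_1,y)-\rho(b_2,y)|\le L|b_1-b_2|$ for all $b_1,b_2\in\mathbb{R}$, $y\in\{0,1\}$. Assume that $X_{ij}\sim Subg(\sigma_{jn}^2)$, that $\beta^*$ exists and is unique, and that for some $\varepsilon,\delta,\vartheta>0$ (not depending on $n$) and non-negative definite matrices $H=H_n\in\mathbb{R}^{p_n\times p_n}$ the margin condition holds: for all $b$ with $b-\beta^*\in\mathcal{C}_\varepsilon\cap B_1(\delta)$, $$R(b)-R(\beta^* )\ge\frac{\vartheta}{2}(b-\beta^* )^TH(b-\beta^* ).$$ Let $\lambda=\lambda_n>0$ satisfy $$\frac{2|s^*|\lambda}{\vartheta\kappa_H(\varepsilon)}\le\frac{2}{4+\varepsilon}\min\left\{\frac{\beta^*_{min}}{2},\delta\right\}.$$ If moreover $\log(p_n\vee 2)=o(\lambda^2n)$, $\kappa_H(\varepsilon)>d$ for some $d>0$ and all large $n$, and $|s^*|\lambda=o(\min\{\beta^*_{min},1\})$, then $$P\left(\|\hat\beta_L-\beta^*\|_1\le\frac{\beta^*_{min}}{2}\right)\to1\quad\text{as } n\to\infty.$$ Moreover, $$P\left(\max_{i\in s^{*c}}|\hat\beta_{L,i}|\le\min_{i\in s^*}|\hat\beta_{L,i}|\right)\to1.$$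
   Context: For each $n$, $(X,Y)=(X^{(n)},Y^{(n)})$ is a random element of $\mathbb{R}^{p_n}\times\{0,1\}$ and $(X_i,Y_i)$, $i=1,\dots,n$, are iid copies of it, $X_i=(X_{i1},\dots,X_{ip_n})^T$; the index $n$ is suppressed, and $\beta^*,s^*,\beta^*_{min}$ may depend on $n$. A random variable $Z$ is $Subg(\sigma^2)$ if $E\exp(tZ)\le\exp(t^2\sigma^2/2)$ for all $t\in\mathbb{R}$. $s_n=\max_{1\le j\le p_n}\sigma_{jn}$. Standing assumptions: $\limsup_ns_n^2<\infty$; no nontrivial linear combination of the coordinates of $X$ is almost surely constant. For $\rho:\mathbb{R}\times\{0,1\}\to\mathbb{R}$ the risk and the empirical risk are $R(b)=E\rho(b^TX,Y)$ and $R_n(b)=\frac1n\sum_{i=1}^n\rho(b^TX_i,Y_i)$, $b\in\mathbb{R}^{p_n}$. $\beta^*=\arg\min_{b\in\mathbb{R}^{p_n}}R(b)$, $s^*=\{i:\beta^*_i\ne0\}$, $s^{*c}=\{1,\dots,p_n\}\setminus s^*$, $\beta^*_{min}=\min_{i\in s^*}|\beta^*_i|$. The Lasso estimator is $\hat\beta_L=(\hat\beta_{L,1},\dots,\hat\beta_{L,p_n})^T=\arg\min_{b\in\mathbb{R}^{p_n}}\{R_n(b)+\lambda\|b\|_1\}$. $v_\pi$ denotes the restriction of $v$ to the coordinates in $\pi$. $\mathcal{C}_\varepsilon=\{\Delta\in\mathbb{R}^{p_n}:\|\Delta_{s^{*c}}\|_1\le(3+\varepsilon)\|\Delta_{s^*}\|_1\}$,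 $B_1(r)=\{\Delta\in\mathbb{R}^{p_n}:\|\Delta\|_1\le r\}$, and $$\kappa_H(\varepsilon)=\inf_{\Delta\in\mathcal{C}_\varepsilon\setminus\{0\}}\frac{\Delta^TH\Delta}{\Delta^T\Delta}.$$ Conventions: infima and minima over the empty set are $+\infty$, maxima over the empty set are $-\infty$. A ratio with positive numerator and denominator $0$ is $+\infty$. $a\vee b=\max(a,b)$. *)

theory Defs
  imports "HOL-Probability.Probability" "HOL-Library.Landau_Symbols"
begin

text \<open>
  A vector of \<open>\<real>\<^sup>p\<close> is an extensional function on the index set \<open>{1..p}\<close>, so that
  \<open>rvec p\<close> is the space of the product measurable space
  \<open>PiM {1..p} (\<lambda>_. borel)\<close> and equality of vectors is equality of functions.
  A matrix is a function of two indices, read only at indices in \<open>{1..p}\<close>.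
\<close>

definition rvec :: "nat \<Rightarrow> (nat \<Rightarrow> real) set" where
  "rvec p = {1..p} \<rightarrow>\<^sub>E UNIV"

definition vzero :: "nat \<Rightarrow> nat \<Rightarrow> real" where
  "vzero p = (\<lambda>j\<in>{1..p}. 0)"

definition vdiff :: "nat \<Rightarrow> (nat \<Rightarrow> real) \<Rightarrow> (nat \<Rightarrow> real) \<Rightarrow> nat \<Rightarrow> real" where
  "vdiff p u v = (\<lambda>j\<in>{1..p}. u j - v j)"

definition dotp :: "nat \<Rightarrow> (nat \<Rightarrow> real) \<Rightarrow> (nat \<Rightarrow> real) \<Rightarrow> real" where
  "dotp p u v = (\<Sum>j\<in>{1..p}. u j * v j)"

definition l1norm_on :: "nat set \<Rightarrow> (nat \<Rightarrow> real) \<Rightarrow> real" where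
  "l1norm_on S v = (\<Sum>j\<in>S. \<bar>v j\<bar>)"

definition quad_form :: "nat \<Rightarrow> (nat \<Rightarrow> nat \<Rightarrow> real) \<Rightarrow> (nat \<Rightarrow> real) \<Rightarrow> real" where
  "quad_form p H v = (\<Sum>j\<in>{1..p}. \<Sum>k\<in>{1..p}. v j * H j k * v k)"

text \<open>Symmetry of the matrix is not required.\<close>

definition nonneg_definite :: "nat \<Rightarrow> (nat \<Rightarrow> nat \<Rightarrow> real) \<Rightarrow> bool" where
  "nonneg_definite p H \<longleftrightarrow> (\<forall>v\<in>rvec p. 0 \<le> quad_form p H v)"

definition obs_space :: "nat \<Rightarrow> ((nat \<Rightarrow> real) \<times> nat) measure" where
  "obs_space p = PiM {1..p} (\<lambda>_. borel) \<Otimes>\<^sub>M count_space {0, 1}"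

text \<open>
  The last argument is the variance proxy \<open>\<sigma>\<^sup>2\<close>. The nonnegative integral is
  used so that the bound includes finiteness of the moment generating function (a Bochner
  integral would be \<open>0\<close> in the non-integrable case).
\<close>

definition subgaussian :: "'a measure \<Rightarrow> ('a \<Rightarrow> real) \<Rightarrow> real \<Rightarrow> bool" where
  "subgaussian M Z v \<longleftrightarrow> Z \<in> borel_measurable M \<and>
     (\<forall>t. (\<integral>\<^sup>+ \<omega>. ennreal (exp (t * Z \<omega>)) \<partial>M) \<le> ennreal (exp (t\<^sup>2 * v / 2)))"

definition risk :: "'a measure \<Rightarrow> nat \<Rightarrow> (real \<Rightarrow> nat \<Rightarrow> real) \<Rightarrow>
    ('a \<Rightarrow> nat \<Rightarrow> real) \<Rightarrow> ('a \<Rightarrow> nat) \<Rightarrow> (nat \<Rightarrow> real) \<Rightarrow> real" where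
  "risk M p \<rho> X Y b = (\<integral>\<omega>. \<rho> (dotp p b (X \<omega>)) (Y \<omega>) \<partial>M)"

text \<open>Here \<open>x i\<close> and \<open>y i\<close>, \<open>i \<in> {1..n}\<close>, are the observed values.\<close>

definition emp_risk :: "nat \<Rightarrow> nat \<Rightarrow> (real \<Rightarrow> nat \<Rightarrow> real) \<Rightarrow>
    (nat \<Rightarrow> nat \<Rightarrow> real) \<Rightarrow> (nat \<Rightarrow> nat) \<Rightarrow> (nat \<Rightarrow> real) \<Rightarrow> real" where
  "emp_risk n p \<rho> x y b = (1 / real n) * (\<Sum>i\<in>{1..n}. \<rho> (dotp p b (x i)) (y i))"

definition lasso_objective :: "nat \<Rightarrow> nat \<Rightarrow> (real \<Rightarrow> nat \<Rightarrow> real) \<Rightarrow> real \<Rightarrow>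
    (nat \<Rightarrow> nat \<Rightarrow> real) \<Rightarrow> (nat \<Rightarrow> nat) \<Rightarrow> (nat \<Rightarrow> real) \<Rightarrow> real" where
  "lasso_objective n p \<rho> lam x y b = emp_risk n p \<rho> x y b + lam * l1norm_on {1..p} b"

definition supp :: "nat \<Rightarrow> (nat \<Rightarrow> real) \<Rightarrow> nat set" where
  "supp p b = {i \<in> {1..p}. b i \<noteq> 0}"

text \<open>
  Minima and maxima that may range over the empty set are taken in \<^typ>\<open>ereal\<close>, where
  the infimum of the empty set is \<open>\<infinity>\<close> and its supremum is \<open>-\<infinity>\<close>.
\<close>

definition beta_min :: "nat \<Rightarrow> (nat \<Rightarrow> real) \<Rightarrow> ereal" where
  "beta_min p b = (INF i\<in>supp p b. ereal \<bar>b i\<bar>)"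

definition cone_eps :: "nat \<Rightarrow> nat set \<Rightarrow> real \<Rightarrow> (nat \<Rightarrow> real) set" where
  "cone_eps p S \<epsilon> = {\<Delta> \<in> rvec p. l1norm_on ({1..p} - S) \<Delta> \<le> (3 + \<epsilon>) * l1norm_on S \<Delta>}"

definition l1ball :: "nat \<Rightarrow> real \<Rightarrow> (nat \<Rightarrow> real) set" where
  "l1ball p r = {\<Delta> \<in> rvec p. l1norm_on {1..p} \<Delta> \<le> r}"

definition kappa :: "nat \<Rightarrow> nat set \<Rightarrow> (nat \<Rightarrow> nat \<Rightarrow> real) \<Rightarrow> real \<Rightarrow> ereal" where
  "kappa p S H \<epsilon> =
     (INF \<Delta>\<in>cone_eps p S \<epsilon> - {vzero p}. ereal (quad_form p H \<Delta> / dotp p \<Delta> \<Delta>))"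

end

theory Submission imports Defs begin

text \<open>
  Put \<open>r = min (\<beta>\<^sub>m\<^sub>i\<^sub>n / 2) \<delta>\<close>. Symmetrization and contraction bound the expected supremum, over the
  \<open>l\<^sub>1\<close>-ball of radius \<open>r\<close> around \<open>\<beta>\<^sup>*\<close>, of the increments of \<open>R - R\<^sub>n\<close> by a multiple of
  \<open>r \<surd>(log p / n)\<close>, so that with probability tending to \<open>1\<close> these increments are at most \<open>\<lambda> r / 2\<close>.
  On that event a point of the sphere of radius \<open>r\<close> whose penalized empirical risk does not exceed that
  of \<open>\<beta>\<^sup>*\<close> lies in the cone, and the margin condition then forces \<open>r\<close> to be at most a multiple of
  \<open>|s\<^sup>*| \<lambda>\<close>, which is impossible for large \<open>n\<close>. Convexity confines all minimizers to the ball.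
\<close>

text \<open>The radius \<open>r\<close> varies with \<open>n\<close> and may shrink, but the
  expected supremum and the threshold \<open>\<lambda> r / 2\<close> are both linear in it. Markov's
  inequality therefore leaves a failure probability of order
  \<open>sqrt (log p / (n \<lambda>^2))\<close>, free of \<open>r\<close>, and this already tends to
  0, so the expectation alone is enough. The factor 1/2 in the threshold is what produces the cone
  constant 3, with \<open>\<epsilon>\<close> as slack. Only one direction matters: the empirical
  increment must not fall far below the increment of the risk. All suprema are accordingly suprema
  of \<open>ennreal\<close> of reals, that is, of positive parts. Their integrals always make sense,
  but the clipping at 0 has to be carried through the contraction step; what makes this possible is
  that the increments vanish at the centre of the ball. A supremum over a ball is uncountable. It is
  taken over a countable dense subset, where it is measurable, and the resulting bound is extended
  to the ball by continuity.\<close>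

section \<open>Contraction and symmetrization for one observation\<close>

lemma ennreal_plus_le: "ennreal (u + v) \<le> ennreal u + ennreal v"
  by (cases "0 \<le> u"; cases "0 \<le> v")
     (auto simp: ennreal_plus[symmetric] ennreal_neg intro!: ennreal_leI simp del: ennreal_plus)

text \<open>The contraction principle for a single random sign. The sum of two suprema is a supremum
  over pairs \<open>(t, t')\<close>, and \<open>t\<close>, \<open>t'\<close> may be swapped on the
  right according to which of \<open>\<psi> t\<close>, \<open>\<psi> t'\<close> is larger;
  \<open>diff\<close> then suffices when neither summand is clipped. If one summand is clipped to 0,
  no pair is left to compare, and \<open>bnd\<close> controls the other one alone.\<close>

lemma two_point_contraction:
  fixes a \<phi> \<psi> :: "'t \<Rightarrow> real"
  assumes "T \<noteq> {}"
    and diff: "\<And>t t'. t \<in> T \<Longrightarrow> t' \<in> T \<Longrightarrow> \<bar>\<phi> t - \<phi> t'\<bar> \<le> \<bar>\<psi> t - \<psi> t'\<bar>"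
    and bnd: "\<And>t. t \<in> T \<Longrightarrow> \<bar>\<phi> t\<bar> \<le> \<bar>\<psi> t\<bar>"
  shows "(SUP t\<in>T. ennreal (a t + \<phi> t)) + (SUP t\<in>T. ennreal (a t - \<phi> t))
       \<le> (SUP t\<in>T. ennreal (a t + \<psi> t)) + (SUP t\<in>T. ennreal (a t - \<psi> t))" (is "_ \<le> ?P + ?Q")
proof -
  have P: "ennreal x \<le> ?P" if "t \<in> T" "x \<le> a t + \<psi> t" for t x
    using that by (intro SUP_upper2[of t]) (auto intro: ennreal_leI)
  have Q: "ennreal x \<le> ?Q" if "t \<in> T" "x \<le> a t - \<psi> t" for t x
    using that by (intro SUP_upper2[of t]) (auto intro: ennreal_leI)
  have PQ: "ennreal x \<le> ?P + ?Q" if "t \<in> T" "x \<le> a t + \<bar>\<psi> t\<bar>" for t x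
  proof (cases "0 \<le> \<psi> t")
    case True
    then show ?thesis using P[of t x] that by (simp add: add_increasing2)
  next
    case False
    then show ?thesis using Q[of t x] that by (simp add: add_increasing)
  qed
  have pt: "ennreal (a t + \<phi> t) + ennreal (a t' - \<phi> t') \<le> ?P + ?Q" if t: "t \<in> T" "t' \<in> T" for t t'
  proof (cases "a t + \<phi> t \<le> 0 \<or> a t' - \<phi> t' \<le> 0")
    case True
    then show ?thesis
      using PQ[of t "a t + \<phi> t"] PQ[of t' "a t' - \<phi> t'"] t bnd[of t] bnd[of t']
      by (auto simp: ennreal_neg)
  next
    case False
    then have eq: "ennreal (a t + \<phi> t) + ennreal (a t' - \<phi> t') = ennreal ((a t + \<phi> t) + (a t' - \<phi> t'))"
      by (simp add: ennreal_plus)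
    show ?thesis
    proof (cases "\<psi> t' \<le> \<psi> t")
      case True
      then have "(a t + \<phi> t) + (a t' - \<phi> t') \<le> (a t + \<psi> t) + (a t' - \<psi> t')"
        using diff[OF t] by linarith
      then have "ennreal ((a t + \<phi> t) + (a t' - \<phi> t')) \<le> ennreal (a t + \<psi> t) + ennreal (a t' - \<psi> t')"
        by (meson ennreal_leI ennreal_plus_le order_trans)
      also have "\<dots> \<le> ?P + ?Q"
        by (intro add_mono P[of t] Q[of t'] t order_refl)
      finally show ?thesis using eq by simp
    next
      case False
      then have "(a t + \<phi> t) + (a t' - \<phi> t') \<le> (a t' + \<psi> t') + (a t - \<psi> t)"
        using diff[OF t] by linarith
      then have "ennreal ((a t + \<phi> t) + (a t' - \<phi> t')) \<le> ennreal (a t' + \<psi> t') + ennreal (a t - \<psi> t)"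
        by (meson ennreal_leI ennreal_plus_le order_trans)
      also have "\<dots> \<le> ?P + ?Q"
        by (intro add_mono P[of t'] Q[of t] t order_refl)
      finally show ?thesis using eq by simp
    qed
  qed
  have "(SUP t\<in>T. ennreal (a t + \<phi> t)) + (SUP t\<in>T. ennreal (a t - \<phi> t))
      = (SUP t\<in>T. SUP t'\<in>T. ennreal (a t + \<phi> t) + ennreal (a t' - \<phi> t'))"
    using assms(1) by (subst ennreal_SUP_add_left[symmetric]) (auto simp: ennreal_SUP_add_right)
  also have "\<dots> \<le> ?P + ?Q"
    by (intro SUP_least pt)
  finally show ?thesis .
qed

text \<open>Jensen's inequality for the positive part, the convex function hidden in
  \<open>ennreal\<close>.\<close>

lemma ennreal_integral_le_nn_integral:
  assumes "integrable M h"
  shows "ennreal (\<integral>x. h x \<partial>M) \<le> (\<integral>\<^sup>+x. ennreal (h x) \<partial>M)"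
proof -
  have "ennreal (\<integral>x. h x \<partial>M) \<le> ennreal (\<integral>x. max 0 (h x) \<partial>M)"
    using assms by (intro ennreal_leI integral_mono) auto
  also have "\<dots> = (\<integral>\<^sup>+x. ennreal (max 0 (h x)) \<partial>M)"
    using assms by (intro nn_integral_eq_integral[symmetric]) auto
  also have "\<dots> = (\<integral>\<^sup>+x. ennreal (h x) \<partial>M)"
    by (intro nn_integral_cong) (auto simp: max_def ennreal_neg)
  finally show ?thesis .
qed

lemma ennreal_midpoint_le: "ennreal (u + v) \<le> (ennreal (2 * u) + ennreal (2 * v)) / 2"
proof -
  have half: "ennreal (2 * x) / 2 = ennreal x" for x
    by (cases "0 \<le> x") (auto simp: ennreal_divide_numeral ennreal_neg)
  have "(ennreal (2 * u) + ennreal (2 * v)) / 2 = ennreal u + ennreal v"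
    by (simp only: add_divide_distrib_ennreal half)
  then show ?thesis using ennreal_plus_le by simp
qed

text \<open>Writing \<open>a + E f - f = \<onehalf> (a + 2 E f) + \<onehalf> (a - 2 f)\<close> makes the usual independent ghost
  sample unnecessary: Jensen's inequality removes the expectation inside the supremum.\<close>

lemma symmetrization_step:
  fixes a :: "'t \<Rightarrow> real" and f g :: "'t \<Rightarrow> 'z \<Rightarrow> real"
  assumes "prob_space \<mu>" and T: "countable T" "T \<noteq> {}"
    and f: "\<And>t. t \<in> T \<Longrightarrow> integrable \<mu> (f t)"
    and g: "\<And>t. t \<in> T \<Longrightarrow> g t \<in> borel_measurable \<mu>"
    and diff: "\<And>z t t'. z \<in> space \<mu> \<Longrightarrow> t \<in> T \<Longrightarrow> t' \<in> T \<Longrightarrow> \<bar>f t z - f t' z\<bar> \<le> \<bar>g t z - g t' z\<bar>"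
    and bnd: "\<And>z t. z \<in> space \<mu> \<Longrightarrow> t \<in> T \<Longrightarrow> \<bar>f t z\<bar> \<le> \<bar>g t z\<bar>"
  shows "(\<integral>\<^sup>+z. (SUP t\<in>T. ennreal (a t + ((\<integral>x. f t x \<partial>\<mu>) - f t z))) \<partial>\<mu>)
       \<le> ((\<integral>\<^sup>+z. (SUP t\<in>T. ennreal (a t + 2 * g t z)) \<partial>\<mu>)
        + (\<integral>\<^sup>+z. (SUP t\<in>T. ennreal (a t - 2 * g t z)) \<partial>\<mu>)) / 2"
proof -
  interpret prob_space \<mu> by fact
  note [measurable] = g
  have fm[measurable]: "f t \<in> borel_measurable \<mu>" if "t \<in> T" for t using f[OF that] by auto
  let ?F = "\<lambda>u. SUP t\<in>T. ennreal (u t)"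
  have [measurable]: "(\<lambda>z. ?F (\<lambda>t. a t + 2 * f t z)) \<in> borel_measurable \<mu>"
    "(\<lambda>z. ?F (\<lambda>t. a t - 2 * f t z)) \<in> borel_measurable \<mu>"
    "(\<lambda>z. ?F (\<lambda>t. a t + 2 * g t z)) \<in> borel_measurable \<mu>"
    "(\<lambda>z. ?F (\<lambda>t. a t - 2 * g t z)) \<in> borel_measurable \<mu>"
    using T by (auto intro!: borel_measurable_SUP)
  have jensen: "?F (\<lambda>t. a t + 2 * (\<integral>x. f t x \<partial>\<mu>)) \<le> (\<integral>\<^sup>+z. ?F (\<lambda>t. a t + 2 * f t z) \<partial>\<mu>)"
  proof (rule SUP_least)
    fix t assume t: "t \<in> T"
    have "a t + 2 * (\<integral>x. f t x \<partial>\<mu>) = (\<integral>x. a t + 2 * f t x \<partial>\<mu>)"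
      using f[OF t] by (simp add: prob_space)
    then have "ennreal (a t + 2 * (\<integral>x. f t x \<partial>\<mu>)) \<le> (\<integral>\<^sup>+z. ennreal (a t + 2 * f t z) \<partial>\<mu>)"
      using ennreal_integral_le_nn_integral[of \<mu> "\<lambda>x. a t + 2 * f t x"] f[OF t] by (simp del: Bochner_Integration.integral_add)
    also have "\<dots> \<le> (\<integral>\<^sup>+z. ?F (\<lambda>t. a t + 2 * f t z) \<partial>\<mu>)"
      using t by (intro nn_integral_mono SUP_upper)
    finally show "ennreal (a t + 2 * (\<integral>x. f t x \<partial>\<mu>)) \<le> (\<integral>\<^sup>+z. ?F (\<lambda>t. a t + 2 * f t z) \<partial>\<mu>)" .
  qed
  have "(\<integral>\<^sup>+z. ?F (\<lambda>t. a t + ((\<integral>x. f t x \<partial>\<mu>) - f t z)) \<partial>\<mu>)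
      \<le> (\<integral>\<^sup>+z. (?F (\<lambda>t. a t + 2 * (\<integral>x. f t x \<partial>\<mu>)) + ?F (\<lambda>t. a t - 2 * f t z)) / 2 \<partial>\<mu>)"
  proof (intro nn_integral_mono SUP_least)
    fix z t assume t: "t \<in> T"
    have "ennreal (a t + ((\<integral>x. f t x \<partial>\<mu>) - f t z))
        \<le> (ennreal (a t + 2 * (\<integral>x. f t x \<partial>\<mu>)) + ennreal (a t - 2 * f t z)) / 2"
      using ennreal_midpoint_le[of "a t / 2 + (\<integral>x. f t x \<partial>\<mu>)" "a t / 2 - f t z"]
      by (simp add: algebra_simps)
    also have "\<dots> \<le> (?F (\<lambda>t. a t + 2 * (\<integral>x. f t x \<partial>\<mu>)) + ?F (\<lambda>t. a t - 2 * f t z)) / 2"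
      using t by (intro divide_right_mono_ennreal add_mono SUP_upper)
    finally show "ennreal (a t + ((\<integral>x. f t x \<partial>\<mu>) - f t z)) \<le> \<dots>" .
  qed
  also have "\<dots> = (?F (\<lambda>t. a t + 2 * (\<integral>x. f t x \<partial>\<mu>)) + (\<integral>\<^sup>+z. ?F (\<lambda>t. a t - 2 * f t z) \<partial>\<mu>)) / 2"
    by (simp add: nn_integral_divide nn_integral_add emeasure_space_1)
  also have "\<dots> \<le> ((\<integral>\<^sup>+z. ?F (\<lambda>t. a t + 2 * f t z) \<partial>\<mu>) + (\<integral>\<^sup>+z. ?F (\<lambda>t. a t - 2 * f t z) \<partial>\<mu>)) / 2"
    by (intro divide_right_mono_ennreal add_mono jensen order_refl)
  also have "\<dots> = (\<integral>\<^sup>+z. ?F (\<lambda>t. a t + 2 * f t z) + ?F (\<lambda>t. a t - 2 * f t z) \<partial>\<mu>) / 2"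
    by (simp add: nn_integral_add)
  \<comment> \<open>For fixed \<open>z\<close> the two suprema are the two outcomes of a fair sign
    in front of \<open>2 * f t z\<close>, so the contraction replaces \<open>f\<close> by
    \<open>g\<close> at no cost in the constant.\<close>
  also have "\<dots> \<le> (\<integral>\<^sup>+z. ?F (\<lambda>t. a t + 2 * g t z) + ?F (\<lambda>t. a t - 2 * g t z) \<partial>\<mu>) / 2"
  proof (intro divide_right_mono_ennreal nn_integral_mono two_point_contraction T)
    fix z t t' assume "z \<in> space \<mu>" "t \<in> T" "t' \<in> T"
    then show "\<bar>2 * f t z - 2 * f t' z\<bar> \<le> \<bar>2 * g t z - 2 * g t' z\<bar>"
      using diff[of z t t'] by linarith
  next
    fix z t assume "z \<in> space \<mu>" "t \<in> T"
    then show "\<bar>2 * f t z\<bar> \<le> \<bar>2 * g t z\<bar>" using bnd[of z t] by (simp add: abs_mult)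
  qed
  also have "\<dots> = ((\<integral>\<^sup>+z. ?F (\<lambda>t. a t + 2 * g t z) \<partial>\<mu>) + (\<integral>\<^sup>+z. ?F (\<lambda>t. a t - 2 * g t z) \<partial>\<mu>)) / 2"
    by (simp add: nn_integral_add)
  finally show ?thesis .
qed

section \<open>Random signs and iteration over the sample\<close>

definition sign_of :: "bool \<Rightarrow> real" where
  "sign_of b = (if b then 1 else - 1)"

text \<open>The law of an observation paired with an independent Rademacher sign. Bundling the sign
  with its observation keeps the sample a product of identical factors, so that induction can treat
  one coordinate at a time.\<close>

definition signed_measure :: "'z measure \<Rightarrow> (bool \<times> 'z) measure" where
  "signed_measure \<mu> = measure_pmf (bernoulli_pmf (1/2)) \<Otimes>\<^sub>M \<mu>"

lemma sets_signed_measure [measurable_cong]: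
  "sets (signed_measure \<mu>) = sets (count_space UNIV \<Otimes>\<^sub>M \<mu>)"
  unfolding signed_measure_def by (intro sets_pair_measure_cong) auto

lemma prob_space_signed_measure: "prob_space \<mu> \<Longrightarrow> prob_space (signed_measure \<mu>)"
  unfolding signed_measure_def
  by (intro prob_space_pair measure_pmf.prob_space_axioms)

lemma nn_integral_signed_measure:
  assumes "prob_space \<mu>" and h: "h \<in> borel_measurable (signed_measure \<mu>)"
  shows "(\<integral>\<^sup>+w. h w \<partial>signed_measure \<mu>)
    = ((\<integral>\<^sup>+z. h (True, z) \<partial>\<mu>) + (\<integral>\<^sup>+z. h (False, z) \<partial>\<mu>)) / 2"
proof -
  interpret prob_space \<mu> by fact
  have "(\<integral>\<^sup>+w. h w \<partial>signed_measure \<mu>)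
      = (\<integral>\<^sup>+b. (\<integral>\<^sup>+z. h (b, z) \<partial>\<mu>) \<partial>measure_pmf (bernoulli_pmf (1/2)))"
    using h unfolding signed_measure_def by (intro nn_integral_fst[symmetric]) auto
  also have "\<dots> = ((\<integral>\<^sup>+z. h (True, z) \<partial>\<mu>) + (\<integral>\<^sup>+z. h (False, z) \<partial>\<mu>)) / 2"
    using ennreal_divide_numeral[of 1 "num.Bit0 num.One"]
    by (simp add: divide_ennreal_def distrib_right)
  finally show ?thesis .
qed

text \<open>Induction on the sample, symmetrizing and contracting each observation in the same step.
  The arbitrary offset \<open>a\<close> makes this possible: it absorbs the terms of all
  observations not being treated. The factor 2 is that of symmetrization.\<close>

lemma symmetrization_contraction:
  fixes a :: "'t \<Rightarrow> real" and f g :: "'t \<Rightarrow> 'z \<Rightarrow> real" and I :: "'i set"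
  assumes \<mu>: "prob_space \<mu>" and T: "countable T" "T \<noteq> {}"
    and f: "\<And>t. t \<in> T \<Longrightarrow> integrable \<mu> (f t)"
    and g: "\<And>t. t \<in> T \<Longrightarrow> g t \<in> borel_measurable \<mu>"
    and diff: "\<And>z t t'. z \<in> space \<mu> \<Longrightarrow> t \<in> T \<Longrightarrow> t' \<in> T \<Longrightarrow> \<bar>f t z - f t' z\<bar> \<le> \<bar>g t z - g t' z\<bar>"
    and bnd: "\<And>z t. z \<in> space \<mu> \<Longrightarrow> t \<in> T \<Longrightarrow> \<bar>f t z\<bar> \<le> \<bar>g t z\<bar>"
    and "finite I"
  shows "(\<integral>\<^sup>+z. (SUP t\<in>T. ennreal (a t + (\<Sum>i\<in>I. (\<integral>x. f t x \<partial>\<mu>) - f t (z i)))) \<partial>PiM I (\<lambda>_. \<mu>))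
    \<le> (\<integral>\<^sup>+w. (SUP t\<in>T. ennreal (a t + (\<Sum>i\<in>I. 2 * sign_of (fst (w i)) * g t (snd (w i)))))
          \<partial>PiM I (\<lambda>_. signed_measure \<mu>))"
  using \<open>finite I\<close>
proof (induction I arbitrary: a)
  case empty
  show ?case by (simp add: PiM_empty nn_integral_count_space_finite)
next
  case (insert i I)
  let ?\<nu> = "signed_measure \<mu>"
  let ?F = "\<lambda>u. SUP t\<in>T. ennreal (u t)"
  let ?d = "\<lambda>t z. (\<integral>x. f t x \<partial>\<mu>) - f t z"
  let ?e = "\<lambda>t w. 2 * sign_of (fst w) * g t (snd w)"
  interpret \<mu>: prob_space \<mu> by fact
  interpret \<nu>: prob_space ?\<nu> by (rule prob_space_signed_measure[OF \<mu>])
  interpret P: product_sigma_finite "\<lambda>_::'i. \<mu>" by standard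
  interpret Q: product_sigma_finite "\<lambda>_::'i. ?\<nu>" by standard
  interpret PI: prob_space "PiM I (\<lambda>_::'i. \<mu>)" by (intro prob_space_PiM \<mu>)
  interpret PN: pair_sigma_finite ?\<nu> "PiM I (\<lambda>_::'i. \<mu>)" by standard
  have [measurable]: "f t \<in> borel_measurable \<mu>" "g t \<in> borel_measurable \<mu>" if "t \<in> T" for t
    using f[OF that] g[OF that] by auto
  have e_meas [measurable]: "?e t \<in> borel_measurable ?\<nu>" if "t \<in> T" for t
    using that unfolding sign_of_def by measurable
  have upd: "(\<Sum>k\<in>insert i I. h ((x(i := y)) k)) = h y + (\<Sum>k\<in>I. h (x k))"
    for h :: "'b \<Rightarrow> real" and x :: "'i \<Rightarrow> 'b" and y
  proof -
    have "(\<Sum>k\<in>I. h ((x(i := y)) k)) = (\<Sum>k\<in>I. h (x k))"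
      using insert.hyps by (intro sum.cong) auto
    then show ?thesis using insert.hyps by simp
  qed
  have "(\<integral>\<^sup>+z. ?F (\<lambda>t. a t + (\<Sum>k\<in>insert i I. ?d t (z k))) \<partial>PiM (insert i I) (\<lambda>_. \<mu>))
      = (\<integral>\<^sup>+z. (\<integral>\<^sup>+y. ?F (\<lambda>t. a t + (\<Sum>k\<in>insert i I. ?d t ((z(i := y)) k))) \<partial>\<mu>) \<partial>PiM I (\<lambda>_. \<mu>))"
    using insert.hyps T by (intro P.product_nn_integral_insert borel_measurable_SUP) auto
  also have "\<dots> = (\<integral>\<^sup>+z. (\<integral>\<^sup>+y. ?F (\<lambda>t. (a t + (\<Sum>k\<in>I. ?d t (z k))) + ?d t y) \<partial>\<mu>) \<partial>PiM I (\<lambda>_. \<mu>))"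
    by (simp only: upd[of "?d _"] add_ac)
  \<comment> \<open>Observation \<open>i\<close> is treated with \<open>z\<close> fixed; the terms
    of the other observations sit in the offset.\<close>
  also have "\<dots> \<le> (\<integral>\<^sup>+z. (\<integral>\<^sup>+w. ?F (\<lambda>t. (a t + (\<Sum>k\<in>I. ?d t (z k))) + ?e t w) \<partial>?\<nu>) \<partial>PiM I (\<lambda>_. \<mu>))"
  proof (rule nn_integral_mono)
    fix z :: "'i \<Rightarrow> 'z"
    let ?a = "\<lambda>t. a t + (\<Sum>k\<in>I. ?d t (z k))"
    have "(\<integral>\<^sup>+y. ?F (\<lambda>t. ?a t + ?d t y) \<partial>\<mu>)
        \<le> ((\<integral>\<^sup>+y. ?F (\<lambda>t. ?a t + 2 * g t y) \<partial>\<mu>) + (\<integral>\<^sup>+y. ?F (\<lambda>t. ?a t - 2 * g t y) \<partial>\<mu>)) / 2"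
      by (rule symmetrization_step[OF \<mu> T f g diff bnd])
    also have "\<dots> = (\<integral>\<^sup>+w. ?F (\<lambda>t. ?a t + ?e t w) \<partial>?\<nu>)"
      using T by (subst nn_integral_signed_measure[OF \<mu>])
        (auto intro!: borel_measurable_SUP simp: sign_of_def)
    finally show "(\<integral>\<^sup>+y. ?F (\<lambda>t. ?a t + ?d t y) \<partial>\<mu>) \<le> (\<integral>\<^sup>+w. ?F (\<lambda>t. ?a t + ?e t w) \<partial>?\<nu>)" .
  qed
  \<comment> \<open>The order of integration is reversed so that the induction hypothesis applies
    for each fixed signed observation \<open>w\<close>, whose term now moves into the
    offset.\<close>
  also have "\<dots> = (\<integral>\<^sup>+w. (\<integral>\<^sup>+z. ?F (\<lambda>t. (a t + (\<Sum>k\<in>I. ?d t (z k))) + ?e t w) \<partial>PiM I (\<lambda>_. \<mu>)) \<partial>?\<nu>)"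
    using T by (intro PN.Fubini' ) (auto simp: case_prod_unfold intro!: borel_measurable_SUP)
  also have "\<dots> = (\<integral>\<^sup>+w. (\<integral>\<^sup>+z. ?F (\<lambda>t. (a t + ?e t w) + (\<Sum>k\<in>I. ?d t (z k))) \<partial>PiM I (\<lambda>_. \<mu>)) \<partial>?\<nu>)"
    by (simp add: add_ac)
  also have "\<dots> \<le> (\<integral>\<^sup>+w. (\<integral>\<^sup>+x. ?F (\<lambda>t. (a t + ?e t w) + (\<Sum>k\<in>I. ?e t (x k))) \<partial>PiM I (\<lambda>_. ?\<nu>)) \<partial>?\<nu>)"
    by (intro nn_integral_mono insert.IH)
  also have "\<dots> = (\<integral>\<^sup>+w. (\<integral>\<^sup>+x. ?F (\<lambda>t. a t + (\<Sum>k\<in>insert i I. ?e t ((x(i := w)) k)))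
      \<partial>PiM I (\<lambda>_. ?\<nu>)) \<partial>?\<nu>)"
    by (simp only: upd[of "?e _"] add_ac)
  also have "\<dots> = (\<integral>\<^sup>+x. ?F (\<lambda>t. a t + (\<Sum>k\<in>insert i I. ?e t (x k))) \<partial>PiM (insert i I) (\<lambda>_. ?\<nu>))"
    using insert.hyps T
    by (intro Q.product_nn_integral_insert_rev[symmetric] borel_measurable_SUP) auto
  finally show ?case .
qed

section \<open>Maximal inequality for signed sub-Gaussian sums\<close>

text \<open>The usual bound of a maximum by the logarithm of a sum of exponentials, with the
  logarithm replaced by its tangent at \<open>K\<close>. The result is affine in the sum and can be
  integrated directly; choosing \<open>K\<close> as a bound of the expected sum loses nothing, since
  then \<open>- 1\<close> and the integrated last term cancel.\<close>

lemma abs_le_log_sum_exp: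
  fixes y :: "'j \<Rightarrow> real"
  assumes "finite J" "j \<in> J" "s > 0" "K > 0"
  shows "\<bar>y j\<bar> \<le> (ln K - 1 + (\<Sum>j\<in>J. exp (s * y j) + exp (- s * y j)) / K) / s"
proof -
  let ?x = "\<Sum>j\<in>J. exp (s * y j) + exp (- s * y j)"
  have "exp (s * \<bar>y j\<bar>) \<le> exp (s * y j) + exp (- s * y j)"
    by (cases "y j \<ge> 0") auto
  also have "\<dots> \<le> ?x"
    using assms by (intro member_le_sum) (auto intro: add_nonneg_nonneg)
  finally have x: "exp (s * \<bar>y j\<bar>) \<le> ?x" .
  then have x0: "?x > 0" using exp_gt_zero less_le_trans by blast
  have "s * \<bar>y j\<bar> \<le> ln ?x" using x x0 by (simp add: ln_ge_iff)
  also have "\<dots> = ln K + ln (?x / K)" using x0 assms by (simp add: ln_div)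
  also have "\<dots> \<le> ln K + (?x / K - 1)"
    using x0 assms by (intro add_left_mono ln_le_minus_one) auto
  finally show ?thesis using assms by (simp add: field_simps)
qed

text \<open>With a random sign, the moment generating function becomes the average of those of
  \<open>h\<close> at \<open>s\<close> and \<open>- s\<close>, so the proxy \<open>v\<close> is
  kept; independence multiplies the bounds.\<close>

lemma nn_integral_exp_signed_sum_le:
  fixes h :: "'z \<Rightarrow> real" and I :: "'i set"
  assumes \<mu>: "prob_space \<mu>" and h: "subgaussian \<mu> h v" and "finite I"
  shows "(\<integral>\<^sup>+w. ennreal (exp (s * (\<Sum>i\<in>I. sign_of (fst (w i)) * h (snd (w i)))))
            \<partial>PiM I (\<lambda>_. signed_measure \<mu>)) \<le> ennreal (exp (real (card I) * (s\<^sup>2 * v / 2)))"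
proof -
  let ?\<nu> = "signed_measure \<mu>"
  interpret \<nu>: prob_space ?\<nu> by (rule prob_space_signed_measure[OF \<mu>])
  interpret Q: product_sigma_finite "\<lambda>_::'i. ?\<nu>" by standard
  have [measurable]: "h \<in> borel_measurable \<mu>" using h by (simp add: subgaussian_def)
  have mgf: "(\<integral>\<^sup>+z. ennreal (exp (t * h z)) \<partial>\<mu>) \<le> ennreal (exp (t\<^sup>2 * v / 2))" for t
    using h by (simp add: subgaussian_def)
  have one: "(\<integral>\<^sup>+w. ennreal (exp (s * (sign_of (fst w) * h (snd w)))) \<partial>?\<nu>) \<le> ennreal (exp (s\<^sup>2 * v / 2))"
  proof -
    have "(\<integral>\<^sup>+w. ennreal (exp (s * (sign_of (fst w) * h (snd w)))) \<partial>?\<nu>)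
      = ((\<integral>\<^sup>+z. ennreal (exp (s * h z)) \<partial>\<mu>) + (\<integral>\<^sup>+z. ennreal (exp ((- s) * h z)) \<partial>\<mu>)) / 2"
      by (subst nn_integral_signed_measure[OF \<mu>]) (simp_all add: sign_of_def)
    also have "\<dots> \<le> (ennreal (exp (s\<^sup>2 * v / 2)) + ennreal (exp (s\<^sup>2 * v / 2))) / 2"
      using mgf[of s] mgf[of "- s"] by (intro divide_right_mono_ennreal add_mono) auto
    also have "\<dots> = ennreal (exp (s\<^sup>2 * v / 2))"
      by (simp add: ennreal_divide_numeral flip: ennreal_plus)
    finally show ?thesis .
  qed
  have "(\<integral>\<^sup>+w. ennreal (exp (s * (\<Sum>i\<in>I. sign_of (fst (w i)) * h (snd (w i))))) \<partial>PiM I (\<lambda>_. ?\<nu>))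
      = (\<integral>\<^sup>+w. (\<Prod>i\<in>I. ennreal (exp (s * (sign_of (fst (w i)) * h (snd (w i)))))) \<partial>PiM I (\<lambda>_. ?\<nu>))"
    using \<open>finite I\<close> by (simp add: sum_distrib_left exp_sum prod_ennreal)
  also have "\<dots> = (\<Prod>i\<in>I. (\<integral>\<^sup>+w. ennreal (exp (s * (sign_of (fst w) * h (snd w)))) \<partial>?\<nu>))"
    by (rule Q.product_nn_integral_prod[OF \<open>finite I\<close>]) (simp add: sign_of_def)
  also have "\<dots> \<le> (\<Prod>i\<in>I. ennreal (exp (s\<^sup>2 * v / 2)))"
    by (intro prod_mono_ennreal one)
  also have "\<dots> = ennreal (exp (real (card I) * (s\<^sup>2 * v / 2)))"
    by (simp only: prod_constant exp_of_nat_mult) (simp add: ennreal_power)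
  finally show ?thesis .
qed

text \<open>Exchanging the sums and pairing the \<open>l1\<close> norm of the coefficients with the
  maximum norm of the coordinate sums \<open>y w j\<close> removes \<open>t\<close>: what remains is
  \<open>B\<close> times a maximum over \<open>J\<close>, controlled by exponential moments.\<close>

lemma expected_sup_linear_le:
  fixes c :: "'t \<Rightarrow> 'j \<Rightarrow> real" and h :: "'j \<Rightarrow> 'z \<Rightarrow> real" and I :: "'i set" and P :: real
  assumes \<mu>: "prob_space \<mu>" and J: "finite J" "real (card J) \<le> P" "P \<ge> 2"
    and h: "\<And>j. j \<in> J \<Longrightarrow> subgaussian \<mu> (h j) v" and v: "v > 0"
    and c: "\<And>t. t \<in> T \<Longrightarrow> (\<Sum>j\<in>J. \<bar>c t j\<bar>) \<le> B" and B: "B \<ge> 0"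
    and I: "finite I" "I \<noteq> {}"
  shows "(\<integral>\<^sup>+w. (SUP t\<in>T. ennreal (\<Sum>i\<in>I. sign_of (fst (w i)) * (\<Sum>j\<in>J. c t j * h j (snd (w i)))))
           \<partial>PiM I (\<lambda>_. signed_measure \<mu>))
      \<le> ennreal (5 / 2 * B * sqrt (real (card I) * v * ln P))"
proof -
  let ?\<nu> = "signed_measure \<mu>"
  define n where "n = real (card I)"
  \<comment> \<open>This \<open>s\<close> equates \<open>ln P / s\<close> with
    \<open>n * v * s\<close>, the two competing parts of the bound. \<open>K\<close> below bounds
    the expectation of at most \<open>2 * P\<close> exponentials.\<close>
  define s where "s = sqrt (ln P / (n * v))"
  define K where "K = 2 * P * exp (n * (s\<^sup>2 * v / 2))"
  define y where "y = (\<lambda>w j. \<Sum>i\<in>I. sign_of (fst (w i)) * h j (snd (w i)))"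
  interpret \<nu>: prob_space ?\<nu> by (rule prob_space_signed_measure[OF \<mu>])
  interpret QI: prob_space "PiM I (\<lambda>_::'i. ?\<nu>)" by (intro prob_space_PiM \<nu>.prob_space_axioms)
  have n: "n > 0" using I by (simp add: n_def card_gt_0_iff)
  have lnP: "ln P > 0" using J by simp
  have s: "s > 0" using n v lnP by (simp add: s_def)
  have s2: "s\<^sup>2 = ln P / (n * v)" using n v lnP by (simp add: s_def)
  have K: "K > 0" using J by (simp add: K_def)
  have lnK: "ln K = ln 2 + ln P + ln P / 2"
    using J n v by (simp add: K_def ln_mult s2)
  \<comment> \<open>Ensures that \<open>ln K - 1\<close> is nonnegative, which is used when passing
    from the sum of coefficients to \<open>B\<close> and when splitting \<open>ennreal\<close> of a
    sum.\<close>
  have "exp 1 \<le> K"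
  proof -
    have "exp 1 \<le> (2 * 2 :: real)" using e_less_272 by simp
    also have "\<dots> \<le> 2 * P * 1" using J by simp
    also have "\<dots> \<le> K" unfolding K_def using J n v by (intro mult_left_mono) auto
    finally show ?thesis .
  qed
  then have lnK1: "ln K \<ge> 1" using K by (simp add: ln_ge_iff)
  have hm [measurable]: "h j \<in> borel_measurable \<mu>" if "j \<in> J" for j
    using h[OF that] by (simp add: subgaussian_def)
  have ym [measurable]: "(\<lambda>w. y w j) \<in> borel_measurable (PiM I (\<lambda>_. ?\<nu>))" if "j \<in> J" for j
    using that unfolding y_def sign_of_def by measurable
  let ?E = "\<lambda>w. \<Sum>j\<in>J. exp (s * y w j) + exp (- s * y w j)"
  have pt: "(\<Sum>i\<in>I. sign_of (fst (w i)) * (\<Sum>j\<in>J. c t j * h j (snd (w i)))) \<le> B / s * (ln K - 1 + ?E w / K)"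
    if t: "t \<in> T" for t w
  proof -
    have "(\<Sum>i\<in>I. sign_of (fst (w i)) * (\<Sum>j\<in>J. c t j * h j (snd (w i)))) = (\<Sum>j\<in>J. c t j * y w j)"
      unfolding y_def sum_distrib_left by (subst sum.swap) (simp add: mult_ac)
    also have "\<dots> \<le> (\<Sum>j\<in>J. \<bar>c t j\<bar> * ((ln K - 1 + ?E w / K) / s))"
    proof (rule sum_mono)
      fix j assume "j \<in> J"
      then have "\<bar>y w j\<bar> \<le> (ln K - 1 + ?E w / K) / s"
        using abs_le_log_sum_exp[OF J(1) _ s K, of j "y w"] by simp
      then have "\<bar>c t j * y w j\<bar> \<le> \<bar>c t j\<bar> * ((ln K - 1 + ?E w / K) / s)"
        unfolding abs_mult by (intro mult_left_mono) auto
      then show "c t j * y w j \<le> \<bar>c t j\<bar> * ((ln K - 1 + ?E w / K) / s)" by simp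
    qed
    also have "\<dots> = (\<Sum>j\<in>J. \<bar>c t j\<bar>) * ((ln K - 1 + ?E w / K) / s)"
      by (simp only: sum_distrib_right)
    also have "\<dots> \<le> B * ((ln K - 1 + ?E w / K) / s)"
      using c[OF t] lnK1 K s
      by (intro mult_right_mono divide_nonneg_pos add_nonneg_nonneg sum_nonneg) (auto intro: sum_nonneg)
    finally show ?thesis by simp
  qed
  have E: "(\<integral>\<^sup>+w. ennreal (?E w) \<partial>PiM I (\<lambda>_. ?\<nu>)) \<le> ennreal K"
  proof -
    have "(\<integral>\<^sup>+w. ennreal (?E w) \<partial>PiM I (\<lambda>_. ?\<nu>))
        = (\<integral>\<^sup>+w. (\<Sum>j\<in>J. ennreal (exp (s * y w j)) + ennreal (exp (- s * y w j))) \<partial>PiM I (\<lambda>_. ?\<nu>))"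
      by (simp add: sum_ennreal[symmetric] add_nonneg_nonneg)
    also have "\<dots> = (\<Sum>j\<in>J. (\<integral>\<^sup>+w. ennreal (exp (s * y w j)) \<partial>PiM I (\<lambda>_. ?\<nu>))
        + (\<integral>\<^sup>+w. ennreal (exp (- s * y w j)) \<partial>PiM I (\<lambda>_. ?\<nu>)))"
      by (subst nn_integral_sum) (auto simp: nn_integral_add)
    also have "\<dots> \<le> (\<Sum>j\<in>J. ennreal (exp (n * (s\<^sup>2 * v / 2))) + ennreal (exp (n * (s\<^sup>2 * v / 2))))"
      using nn_integral_exp_signed_sum_le[OF \<mu> h I(1), of _ s]
        nn_integral_exp_signed_sum_le[OF \<mu> h I(1), of _ "- s"]
      by (intro sum_mono add_mono) (simp_all add: y_def n_def)
    also have "\<dots> = ennreal (real (card J) * (2 * exp (n * (s\<^sup>2 * v / 2))))"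
      by (simp add: ennreal_of_nat_eq_real_of_nat flip: ennreal_plus ennreal_mult')
    also have "\<dots> \<le> ennreal K"
      using J unfolding K_def by (intro ennreal_leI) simp
    finally show ?thesis .
  qed
  have "(\<integral>\<^sup>+w. (SUP t\<in>T. ennreal (\<Sum>i\<in>I. sign_of (fst (w i)) * (\<Sum>j\<in>J. c t j * h j (snd (w i)))))
           \<partial>PiM I (\<lambda>_. ?\<nu>))
      \<le> (\<integral>\<^sup>+w. ennreal (B / s * (ln K - 1)) + ennreal (B / s / K) * ennreal (?E w) \<partial>PiM I (\<lambda>_. ?\<nu>))"
  proof (intro nn_integral_mono SUP_least)
    fix w :: "'i \<Rightarrow> bool \<times> 'z" and t assume t: "t \<in> T"
    have "0 \<le> ?E w" by (intro sum_nonneg) (simp add: add_nonneg_nonneg)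
    then have "ennreal (B / s * (ln K - 1)) + ennreal (B / s / K) * ennreal (?E w)
        = ennreal (B / s * (ln K - 1) + B / s / K * ?E w)"
      using B s K lnK1 by (subst ennreal_mult[symmetric], simp_all only: ennreal_plus[symmetric]
        mult_nonneg_nonneg divide_nonneg_pos diff_ge_0_iff_ge)
    also have "B / s * (ln K - 1) + B / s / K * ?E w = B / s * (ln K - 1 + ?E w / K)"
      by (simp only: distrib_left times_divide_eq_left times_divide_eq_right mult.commute)
    finally have "ennreal (B / s * (ln K - 1)) + ennreal (B / s / K) * ennreal (?E w)
        = ennreal (B / s * (ln K - 1 + ?E w / K))" .
    then show "ennreal (\<Sum>i\<in>I. sign_of (fst (w i)) * (\<Sum>j\<in>J. c t j * h j (snd (w i))))
        \<le> ennreal (B / s * (ln K - 1)) + ennreal (B / s / K) * ennreal (?E w)"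
      using pt[OF t, of w] by (simp add: ennreal_leI)
  qed
  also have "\<dots> = ennreal (B / s * (ln K - 1)) + ennreal (B / s / K) * (\<integral>\<^sup>+w. ennreal (?E w) \<partial>PiM I (\<lambda>_. ?\<nu>))"
    by (subst nn_integral_add) (auto simp: nn_integral_cmult QI.emeasure_space_1)
  also have "\<dots> \<le> ennreal (B / s * (ln K - 1)) + ennreal (B / s / K) * ennreal K"
    by (intro add_left_mono mult_left_mono E) auto
  also have "\<dots> = ennreal (B / s * (ln K - 1) + B / s / K * K)"
    using B s K lnK1 by (subst ennreal_mult[symmetric], simp_all only: ennreal_plus[symmetric]
      mult_nonneg_nonneg divide_nonneg_pos diff_ge_0_iff_ge)
  also have "B / s * (ln K - 1) + B / s / K * K = B / s * ln K"
    using K by (simp add: right_diff_distrib)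
  also have "\<dots> \<le> ennreal (5 / 2 * B * sqrt (n * v * ln P))"
  proof (rule ennreal_leI)
    \<comment> \<open>The exponent in \<open>K\<close> equals \<open>ln P / 2\<close>, so
      \<open>ln K\<close> is \<open>ln 2 + 3 / 2 * ln P\<close>; with \<open>P \<ge> 2\<close> this
      gives the constant \<open>5 / 2\<close>.\<close>
    have "ln 2 \<le> ln P" using J by simp
    then have "ln K \<le> 5 / 2 * ln P" using lnK by simp
    then have "B / s * ln K \<le> B / s * (5 / 2 * ln P)"
      using B s by (intro mult_left_mono) auto
    also have "\<dots> = 5 / 2 * B * (ln P / s)" by simp
    also have "ln P / s = sqrt (n * v * ln P)"
    proof -
      have "ln P / s = sqrt (ln P * ln P) / s" using lnP by simp
      also have "\<dots> = sqrt (ln P * ln P / (ln P / (n * v)))"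
        unfolding s_def by (simp only: real_sqrt_divide)
      also have "ln P * ln P / (ln P / (n * v)) = n * v * ln P"
        using lnP by simp
      finally show ?thesis .
    qed
    finally show "B / s * ln K \<le> 5 / 2 * B * sqrt (n * v * ln P)" .
  qed
  finally show ?thesis unfolding n_def .
qed

section \<open>Sub-Gaussian laws, continuity and measurability of the loss\<close>

lemma subgaussian_mono:
  assumes "subgaussian M Z v" "v \<le> v'"
  shows "subgaussian M Z v'"
proof -
  have "t\<^sup>2 * v / 2 \<le> t\<^sup>2 * v' / 2" for t
    using assms by (simp add: mult_left_mono)
  then show ?thesis
    using assms unfolding subgaussian_def by (meson ennreal_leI exp_le_cancel_iff order_trans)
qed

lemma subgaussian_distr_iff:
  assumes "F \<in> M \<rightarrow>\<^sub>M N" "Z \<in> borel_measurable N"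
  shows "subgaussian (distr M N F) Z v \<longleftrightarrow> subgaussian M (\<lambda>\<omega>. Z (F \<omega>)) v"
  using assms by (simp add: subgaussian_def nn_integral_distr)

lemma subgaussian_integrable:
  assumes "subgaussian M Z v"
  shows "integrable M Z"
proof -
  have [measurable]: "Z \<in> borel_measurable M" using assms by (simp add: subgaussian_def)
  have mgf: "(\<integral>\<^sup>+ \<omega>. ennreal (exp (t * Z \<omega>)) \<partial>M) < \<infinity>" for t
    using assms unfolding subgaussian_def by (metis ennreal_less_top infinity_ennreal_def order_le_less_trans)
  have "(\<integral>\<^sup>+ \<omega>. ennreal (norm (Z \<omega>)) \<partial>M)
      \<le> (\<integral>\<^sup>+ \<omega>. ennreal (exp (1 * Z \<omega>)) + ennreal (exp (- 1 * Z \<omega>)) \<partial>M)"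
  proof (rule nn_integral_mono)
    fix \<omega>
    have "norm (Z \<omega>) \<le> exp (Z \<omega>) + exp (- Z \<omega>)"
      using exp_ge_add_one_self[of "Z \<omega>"] exp_ge_add_one_self[of "- Z \<omega>"]
        exp_gt_zero[of "Z \<omega>"] exp_gt_zero[of "- Z \<omega>"]
      unfolding real_norm_def by linarith
    then show "ennreal (norm (Z \<omega>)) \<le> ennreal (exp (1 * Z \<omega>)) + ennreal (exp (- 1 * Z \<omega>))"
      by (simp add: ennreal_leI flip: ennreal_plus)
  qed
  also have "\<dots> = (\<integral>\<^sup>+ \<omega>. ennreal (exp (1 * Z \<omega>)) \<partial>M) + (\<integral>\<^sup>+ \<omega>. ennreal (exp (- 1 * Z \<omega>)) \<partial>M)"
    by (rule nn_integral_add) auto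
  also have "\<dots> < \<infinity>" using mgf[of 1] mgf[of "- 1"] by simp
  finally show ?thesis by (simp add: integrable_iff_bounded)
qed

text \<open>Vectors are functions on all indices with the product topology, not elements of a normed
  space, so Lipschitz continuity in the weighted coordinates has to be turned into continuity there.
  It is needed for extending bounds from a dense subset and for attaining minima on balls.\<close>

lemma continuous_on_weighted_l1:
  fixes F :: "('i :: countable \<Rightarrow> real) \<Rightarrow> real"
  assumes "\<And>b b'. \<bar>F b - F b'\<bar> \<le> (\<Sum>j\<in>J. C j * \<bar>b j - b' j\<bar>)"
  shows "continuous_on UNIV F"
proof (subst continuous_on_eq_continuous_at, simp, intro ballI)
  fix b :: "'i \<Rightarrow> real"
  let ?h = "\<lambda>b'. \<Sum>j\<in>J. C j * \<bar>b' j - b j\<bar>"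
  have "continuous_on UNIV ?h" by (intro continuous_intros) auto
  then have "isCont ?h b" by (simp add: continuous_on_eq_continuous_at)
  then have h: "(?h \<longlongrightarrow> 0) (at b)" by (simp add: isCont_def)
  have "((\<lambda>b'. F b' - F b) \<longlongrightarrow> 0) (at b)"
    by (rule Lim_null_comparison[OF _ h]) (auto intro!: always_eventually assms)
  then show "isCont F b" by (simp add: isCont_def LIM_zero_iff)
qed

lemma dotp_diff: "dotp p b x - dotp p b' x = (\<Sum>j\<in>{1..p}. (b j - b' j) * x j)"
  by (simp add: dotp_def sum_subtractf left_diff_distrib)

lemma loss_lipschitz:
  assumes lip: "\<And>b1 b2 y. y \<in> {0, 1} \<Longrightarrow> \<bar>\<rho> b1 y - \<rho> b2 y\<bar> \<le> L * \<bar>b1 - b2\<bar>"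
    and "y \<in> {0, 1 :: nat}" "L > 0"
  shows "\<bar>\<rho> (dotp p b x) y - \<rho> (dotp p b' x) y\<bar> \<le> (\<Sum>j\<in>{1..p}. L * \<bar>x j\<bar> * \<bar>b j - b' j\<bar>)"
proof -
  have "\<bar>\<rho> (dotp p b x) y - \<rho> (dotp p b' x) y\<bar> \<le> L * \<bar>\<Sum>j\<in>{1..p}. (b j - b' j) * x j\<bar>"
    using lip[OF assms(2), of "dotp p b x" "dotp p b' x"] by (simp add: dotp_diff)
  also have "\<dots> \<le> L * (\<Sum>j\<in>{1..p}. \<bar>(b j - b' j) * x j\<bar>)"
    using assms by (intro mult_left_mono sum_abs) auto
  finally show ?thesis by (simp add: abs_mult sum_distrib_left mult_ac)
qed

lemma continuous_on_emp_risk: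
  assumes lip: "\<And>b1 b2 y. y \<in> {0, 1} \<Longrightarrow> \<bar>\<rho> b1 y - \<rho> b2 y\<bar> \<le> L * \<bar>b1 - b2\<bar>"
    and "L > 0" and y: "\<And>i. i \<in> {1..n} \<Longrightarrow> y i \<in> {0, 1 :: nat}"
  shows "continuous_on UNIV (emp_risk n p \<rho> x y)"
proof -
  have "continuous_on UNIV (\<lambda>b. \<rho> (dotp p b (x i)) (y i))" if "i \<in> {1..n}" for i
    by (rule continuous_on_weighted_l1) (rule loss_lipschitz[OF lip y[OF that] \<open>L > 0\<close>])
  then show ?thesis unfolding emp_risk_def by (intro continuous_intros) auto
qed

lemma rv_obs_fst [measurable]:
  "j \<in> {1..p} \<Longrightarrow> (\<lambda>z. fst z j) \<in> borel_measurable (obs_space p)"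
  unfolding obs_space_def by measurable

text \<open>Measurability of \<open>\<rho>\<close> comes from its Lipschitz continuity in the first
  argument; since labels in \<open>obs_space p\<close> are 0 or 1, a case distinction on the label
  reduces the joint statement to two continuous functions.\<close>

lemma loss_measurable:
  assumes lip: "\<And>b1 b2 y. y \<in> {0, 1} \<Longrightarrow> \<bar>\<rho> b1 y - \<rho> b2 y\<bar> \<le> L * \<bar>b1 - b2\<bar>"
    and "L > 0"
  shows "(\<lambda>z. \<rho> (dotp p b (fst z)) (snd z)) \<in> borel_measurable (obs_space p)"
proof -
  have cont: "continuous_on UNIV (\<lambda>u. \<rho> u y)" if y: "y \<in> {0, 1}" for y
    using \<open>L > 0\<close> lip[OF y]
    by (intro lipschitz_on_continuous_on[of L] lipschitz_onI) (auto simp: dist_real_def)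
  have [measurable]: "(\<lambda>u. \<rho> u 0) \<in> borel_measurable borel" "(\<lambda>u. \<rho> u 1) \<in> borel_measurable borel"
    by (auto intro!: borel_measurable_continuous_onI cont)
  have [measurable]: "snd \<in> obs_space p \<rightarrow>\<^sub>M count_space UNIV"
    unfolding obs_space_def
    by (rule measurable_compose[OF measurable_snd]) simp
  have "(\<lambda>z. if snd z = 0 then \<rho> (dotp p b (fst z)) 0 else \<rho> (dotp p b (fst z)) 1)
      \<in> borel_measurable (obs_space p)"
    unfolding dotp_def by measurable
  then show ?thesis
    by (rule measurable_cong[THEN iffD1, rotated]) (auto simp: obs_space_def space_pair_measure)
qed

section \<open>Uniform one-sided deviation on an \<open>l1\<close> ball\<close>

text \<open>The constant \<open>5 * L * r\<close> is the \<open>5 / 2\<close> of the maximal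
  inequality times \<open>2 * L * r\<close>: symmetrization, Lipschitz constant, radius. The
  conclusion supplies an event \<open>A\<close> because the set on which the bound holds over the
  whole uncountable ball is not evidently measurable.\<close>

lemma deviation_bound:
  fixes M :: "'a measure" and X :: "'a \<Rightarrow> nat \<Rightarrow> real" and Y :: "'a \<Rightarrow> nat"
    and Xs :: "nat \<Rightarrow> 'a \<Rightarrow> nat \<Rightarrow> real" and Ys :: "nat \<Rightarrow> 'a \<Rightarrow> nat" and \<rho> :: "real \<Rightarrow> nat \<Rightarrow> real"
  assumes prob: "prob_space M" and n: "n \<ge> 1"
    and pair: "(\<lambda>\<omega>. (X \<omega>, Y \<omega>)) \<in> M \<rightarrow>\<^sub>M obs_space p"
    and indep: "prob_space.indep_vars M (\<lambda>_. obs_space p) (\<lambda>i \<omega>. (Xs i \<omega>, Ys i \<omega>)) {1..n}"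
    and copies: "\<And>i. i \<in> {1..n} \<Longrightarrow>
      distr M (obs_space p) (\<lambda>\<omega>. (Xs i \<omega>, Ys i \<omega>)) = distr M (obs_space p) (\<lambda>\<omega>. (X \<omega>, Y \<omega>))"
    and subg: "\<And>i j. i \<in> {1..n} \<Longrightarrow> j \<in> {1..p} \<Longrightarrow> subgaussian M (\<lambda>\<omega>. Xs i \<omega> j) v"
    and v: "v > 0" and L: "L > 0"
    and lip: "\<And>b1 b2 y. y \<in> {0, 1} \<Longrightarrow> \<bar>\<rho> b1 y - \<rho> b2 y\<bar> \<le> L * \<bar>b1 - b2\<bar>"
    and \<beta>: "\<beta> \<in> rvec p" and r: "r > 0" and t: "t > 0"
  obtains A where "A \<in> sets M"
    "measure M A \<ge> 1 - 5 * L * r * sqrt (v * ln (real (max p 2)) / real n) / t"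
    "\<And>\<omega> b. \<omega> \<in> A \<Longrightarrow> b \<in> rvec p \<Longrightarrow> l1norm_on {1..p} (vdiff p b \<beta>) \<le> r \<Longrightarrow>
      (risk M p \<rho> X Y b - risk M p \<rho> X Y \<beta>)
        - (emp_risk n p \<rho> (\<lambda>i. Xs i \<omega>) (\<lambda>i. Ys i \<omega>) b
           - emp_risk n p \<rho> (\<lambda>i. Xs i \<omega>) (\<lambda>i. Ys i \<omega>) \<beta>) \<le> t"
proof -
  interpret prob_space M by fact
  define \<mu> where "\<mu> = distr M (obs_space p) (\<lambda>\<omega>. (X \<omega>, Y \<omega>))"
  define P where "P = real (max p 2)"
  define Z where "Z = (\<lambda>i \<omega>. (Xs i \<omega>, Ys i \<omega>))"
  define \<l> where "\<l> = (\<lambda>b z. \<rho> (dotp p b (fst z)) (snd z))"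
  define K where "K = {b \<in> rvec p. l1norm_on {1..p} (vdiff p b \<beta>) \<le> r}"
  have \<mu>: "prob_space \<mu>" unfolding \<mu>_def using pair by (rule prob_space_distr)
  interpret \<mu>: prob_space \<mu> by fact
  have sets_\<mu> [measurable_cong]: "sets \<mu> = sets (obs_space p)" by (simp add: \<mu>_def)
  have Zm [measurable]: "Z i \<in> M \<rightarrow>\<^sub>M obs_space p" if "i \<in> {1..n}" for i
    using indep that unfolding indep_vars_def Z_def by blast
  have Z\<mu>: "distr M (obs_space p) (Z i) = \<mu>" if "i \<in> {1..n}" for i
    using copies[OF that] by (simp add: Z_def \<mu>_def)
  have sp: "snd z \<in> {0, 1}" if "z \<in> space \<mu>" for z
    using that by (auto simp: \<mu>_def obs_space_def space_pair_measure)
  have Ys: "Ys i \<omega> \<in> {0, 1}" if "i \<in> {1..n}" "\<omega> \<in> space M" for i \<omega>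
    using measurable_space[OF Zm[OF that(1)] that(2)]
    by (auto simp: Z_def obs_space_def space_pair_measure)
  \<comment> \<open>Sub-Gaussianity is given for the sample; it passes to the common law
    \<open>\<mu>\<close> through observation 1, which exists because
    \<open>n \<ge> 1\<close>.\<close>
  have coord_subg: "subgaussian \<mu> (\<lambda>z. fst z j) v" if "j \<in> {1..p}" for j
  proof -
    have "1 \<in> {1..n}" using n by simp
    then show ?thesis
      using subg[of 1 j] that Zm[of 1]
      unfolding Z\<mu>[OF \<open>1 \<in> {1..n}\<close>, symmetric]
      by (subst subgaussian_distr_iff) (auto simp: Z_def)
  qed
  have coord_int: "integrable \<mu> (\<lambda>z. fst z j)" if "j \<in> {1..p}" for j
    using subgaussian_integrable[OF coord_subg[OF that]] .
  have \<l>_meas: "\<l> b \<in> borel_measurable (obs_space p)" for b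
    unfolding \<l>_def by (rule loss_measurable[OF lip L])
  have \<l>_lip: "\<bar>\<l> b z - \<l> b' z\<bar> \<le> (\<Sum>j\<in>{1..p}. L * \<bar>fst z j\<bar> * \<bar>b j - b' j\<bar>)" if "z \<in> space \<mu>" for z b b'
    unfolding \<l>_def by (rule loss_lipschitz[OF lip sp[OF that] L])
  have \<l>_int: "integrable \<mu> (\<l> b)" for b
  proof (rule Bochner_Integration.integrable_bound)
    let ?u = "\<lambda>z. \<bar>\<rho> 0 0\<bar> + \<bar>\<rho> 0 1\<bar> + (\<Sum>j\<in>{1..p}. L * \<bar>fst z j\<bar> * \<bar>b j - 0\<bar>)"
    show "integrable \<mu> ?u"
      by (intro Bochner_Integration.integrable_add Bochner_Integration.integrable_sum
        integrable_mult_left integrable_mult_right integrable_abs coord_int) auto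
    show "\<l> b \<in> borel_measurable \<mu>" using \<l>_meas[of b] by (simp add: \<mu>_def)
    show "AE z in \<mu>. norm (\<l> b z) \<le> norm (?u z)"
    proof (rule AE_I2)
      fix z assume z: "z \<in> space \<mu>"
      have "\<l> (\<lambda>_. 0) z = \<rho> 0 (snd z)" by (simp add: \<l>_def dotp_def)
      then have "\<bar>\<l> (\<lambda>_. 0) z\<bar> \<le> \<bar>\<rho> 0 0\<bar> + \<bar>\<rho> 0 1\<bar>" using sp[OF z] by auto
      moreover have "\<bar>\<l> b z - \<l> (\<lambda>_. 0) z\<bar> \<le> (\<Sum>j\<in>{1..p}. L * \<bar>fst z j\<bar> * \<bar>b j - 0\<bar>)"
        by (rule \<l>_lip[OF z])
      ultimately show "norm (\<l> b z) \<le> norm (?u z)" by simp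
    qed
  qed
  have risk_eq: "risk M p \<rho> X Y b = (\<integral>z. \<l> b z \<partial>\<mu>)" for b
    using pair \<l>_meas[of b] by (simp add: risk_def \<mu>_def integral_distr) (simp add: \<l>_def)
  have risk_cont: "continuous_on UNIV (risk M p \<rho> X Y)"
  proof (rule continuous_on_weighted_l1)
    fix b b' :: "nat \<Rightarrow> real"
    have "\<bar>risk M p \<rho> X Y b - risk M p \<rho> X Y b'\<bar> = \<bar>\<integral>z. \<l> b z - \<l> b' z \<partial>\<mu>\<bar>"
      unfolding risk_eq using \<l>_int by simp
    also have "\<dots> \<le> (\<integral>z. \<bar>\<l> b z - \<l> b' z\<bar> \<partial>\<mu>)" by (rule integral_abs_bound)
    also have "\<dots> \<le> (\<integral>z. (\<Sum>j\<in>{1..p}. L * \<bar>fst z j\<bar> * \<bar>b j - b' j\<bar>) \<partial>\<mu>)"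
      using coord_int \<l>_int \<l>_lip by (intro integral_mono) auto
    also have "\<dots> = (\<Sum>j\<in>{1..p}. L * (\<integral>z. \<bar>fst z j\<bar> \<partial>\<mu>) * \<bar>b j - b' j\<bar>)"
      using coord_int by (subst Bochner_Integration.integral_sum) auto
    finally show "\<bar>risk M p \<rho> X Y b - risk M p \<rho> X Y b'\<bar>
      \<le> (\<Sum>j\<in>{1..p}. L * (\<integral>z. \<bar>fst z j\<bar> \<partial>\<mu>) * \<bar>b j - b' j\<bar>)" .
  qed
  \<comment> \<open>A countable dense subset of the ball, over which suprema are measurable.\<close>
  obtain T where T: "countable T" "T \<subseteq> K" "K \<subseteq> closure T" using separable[of K] by metis
  have "\<beta> \<in> K" using \<beta> r by (simp add: K_def vdiff_def l1norm_on_def)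
  then have "T \<noteq> {}" using T by auto
  define f where "f = (\<lambda>b z. \<l> b z - \<l> \<beta> z)"
  \<comment> \<open>The Lipschitz constant is put into the linear process \<open>g\<close>, so that
    \<open>f\<close> is a contraction of it with constant 1, and both vanish at
    \<open>\<beta>\<close>.\<close>
  define g where "g = (\<lambda>b (z :: (nat \<Rightarrow> real) \<times> nat). \<Sum>j\<in>{1..p}. L * (b j - \<beta> j) * fst z j)"
  have f_int: "integrable \<mu> (f b)" for b unfolding f_def using \<l>_int by simp
  have [measurable]: "f b \<in> borel_measurable \<mu>" for b using f_int by auto
  have g_meas [measurable]: "g b \<in> borel_measurable \<mu>" for b
    unfolding g_def using coord_int by (intro borel_measurable_sum borel_measurable_times) auto
  have fg: "\<bar>f b z - f b' z\<bar> \<le> \<bar>g b z - g b' z\<bar>" if "z \<in> space \<mu>" for b b' z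
  proof -
    have "\<bar>f b z - f b' z\<bar> \<le> L * \<bar>dotp p b (fst z) - dotp p b' (fst z)\<bar>"
      using lip[OF sp[OF that]] by (simp add: f_def \<l>_def)
    also have "\<dots> = \<bar>L * (\<Sum>j\<in>{1..p}. (b j - b' j) * fst z j)\<bar>"
      using L by (simp add: dotp_diff abs_mult)
    also have "L * (\<Sum>j\<in>{1..p}. (b j - b' j) * fst z j) = g b z - g b' z"
      unfolding g_def sum_subtractf[symmetric] sum_distrib_left by (simp add: algebra_simps)
    finally show ?thesis .
  qed
  have fg0: "\<bar>f b z\<bar> \<le> \<bar>g b z\<bar>" if "z \<in> space \<mu>" for b z
    using fg[OF that, of b \<beta>] by (simp add: f_def g_def)
  let ?U = "\<lambda>z. SUP b\<in>T. ennreal (\<Sum>i\<in>{1..n}. (\<integral>x. f b x \<partial>\<mu>) - f b (z i))"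
  have U_meas [measurable]: "?U \<in> borel_measurable (PiM {1..n} (\<lambda>_. \<mu>))"
    using T by (intro borel_measurable_SUP) auto
  have c: "(\<Sum>j\<in>{1..p}. \<bar>2 * L * (b j - \<beta> j)\<bar>) \<le> 2 * L * r" if "b \<in> T" for b
  proof -
    have "(\<Sum>j\<in>{1..p}. \<bar>b j - \<beta> j\<bar>) \<le> r"
      using that T by (auto simp: K_def l1norm_on_def vdiff_def)
    then have "2 * L * (\<Sum>j\<in>{1..p}. \<bar>b j - \<beta> j\<bar>) \<le> 2 * L * r" using L by simp
    then show ?thesis using L by (simp add: abs_mult sum_distrib_left)
  qed
  have "(\<integral>\<^sup>+z. ?U z \<partial>PiM {1..n} (\<lambda>_. \<mu>))
      \<le> (\<integral>\<^sup>+w. (SUP b\<in>T. ennreal (\<Sum>i\<in>{1..n}. 2 * sign_of (fst (w i)) * g b (snd (w i))))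
          \<partial>PiM {1..n} (\<lambda>_. signed_measure \<mu>))"
    using symmetrization_contraction[OF \<mu> T(1) \<open>T \<noteq> {}\<close> f_int g_meas fg fg0, of "{1..n}" "\<lambda>_. 0"]
    by simp
  also have "\<dots> = (\<integral>\<^sup>+w. (SUP b\<in>T. ennreal (\<Sum>i\<in>{1..n}. sign_of (fst (w i)) *
      (\<Sum>j\<in>{1..p}. (2 * L * (b j - \<beta> j)) * fst (snd (w i)) j)))
          \<partial>PiM {1..n} (\<lambda>_. signed_measure \<mu>))"
    by (simp only: g_def sum_distrib_left mult_ac)
  also have "\<dots> \<le> ennreal (5 / 2 * (2 * L * r) * sqrt (real (card {1..n}) * v * ln P))"
    using L r n unfolding P_def
    by (intro expected_sup_linear_le[OF \<mu> _ _ _ coord_subg v c]) auto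
  finally have EU: "(\<integral>\<^sup>+z. ?U z \<partial>PiM {1..n} (\<lambda>_. \<mu>)) \<le> ennreal (5 * L * r * sqrt (real n * v * ln P))"
    by (simp add: mult.assoc)
  \<comment> \<open>Independence and equal laws identify the product measure with the joint law of
    the sample, which carries the expectation bound over to \<open>M\<close>.\<close>
  have law: "PiM {1..n} (\<lambda>_. \<mu>) = distr M (PiM {1..n} (\<lambda>_. obs_space p)) (\<lambda>\<omega>. \<lambda>i\<in>{1..n}. Z i \<omega>)"
  proof -
    have "distr M (PiM {1..n} (\<lambda>_. obs_space p)) (\<lambda>\<omega>. \<lambda>i\<in>{1..n}. Z i \<omega>)
        = PiM {1..n} (\<lambda>i. distr M (obs_space p) (Z i))"
      using indep n by (subst indep_vars_iff_distr_eq_PiM'[symmetric]) (auto simp: Z_def[symmetric])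
    also have "\<dots> = PiM {1..n} (\<lambda>_. \<mu>)" using Z\<mu> by (intro PiM_cong) auto
    finally show ?thesis ..
  qed
  define V where "V = (\<lambda>\<omega>. SUP b\<in>T. ennreal (\<Sum>i\<in>{1..n}. (\<integral>x. f b x \<partial>\<mu>) - f b (Z i \<omega>)))"
  have f_meas': "f b \<in> borel_measurable (obs_space p)" for b
    unfolding f_def using \<l>_meas by measurable
  have [measurable]: "V \<in> borel_measurable M"
    unfolding V_def using T
    by (intro borel_measurable_SUP) (auto intro!: borel_measurable_sum borel_measurable_diff
      measurable_compose[OF Zm f_meas'])
  have "(\<integral>\<^sup>+\<omega>. V \<omega> \<partial>M) = (\<integral>\<^sup>+z. ?U z \<partial>PiM {1..n} (\<lambda>_. \<mu>))"
    using U_meas unfolding law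
    by (subst nn_integral_distr) (auto simp: V_def intro!: measurable_restrict Zm)
  then have EV: "(\<integral>\<^sup>+\<omega>. V \<omega> \<partial>M) \<le> ennreal (5 * L * r * sqrt (real n * v * ln P))" using EU by (simp only:)
  \<comment> \<open>\<open>V\<close> collects sums over the sample without the factor
    \<open>1 / n\<close>, so Markov's inequality is applied at level \<open>n * t\<close>;
    \<open>A\<close> is the event \<open>V < n * t\<close>.\<close>
  define A where "A = {\<omega> \<in> space M. \<not> 1 \<le> ennreal (1 / (n * t)) * V \<omega>}"
  have [measurable]: "A \<in> sets M" unfolding A_def by measurable
  have "emeasure M {\<omega> \<in> space M. 1 \<le> ennreal (1 / (n * t)) * V \<omega>}
      \<le> ennreal (1 / (n * t)) * (\<integral>\<^sup>+\<omega>. V \<omega> * indicator (space M) \<omega> \<partial>M)"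
    using nn_integral_Markov_inequality[of V "space M" M "ennreal (1 / (n * t))"] by simp
  also have "\<dots> = ennreal (1 / (n * t)) * (\<integral>\<^sup>+\<omega>. V \<omega> \<partial>M)"
    by (intro arg_cong2[where f="(*)"] nn_integral_cong refl) auto
  also have "\<dots> \<le> ennreal (1 / (n * t)) * ennreal (5 * L * r * sqrt (real n * v * ln P))"
    by (intro mult_left_mono EV) auto
  also have "\<dots> = ennreal (1 / (n * t) * (5 * L * r * sqrt (real n * v * ln P)))"
    using t by (intro ennreal_mult'[symmetric]) auto
  also have "1 / (n * t) * (5 * L * r * sqrt (real n * v * ln P)) = 5 * L * r * sqrt (v * ln P / n) / t"
  proof -
    have "sqrt (real n * v * ln P) / n = sqrt (real n * v * ln P) / sqrt (real n * real n)" by simp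
    also have "\<dots> = sqrt (real n * v * ln P / (real n * real n))"
      by (simp only: real_sqrt_divide)
    also have "real n * v * ln P / (real n * real n) = v * ln P / n" using n by simp
    finally show ?thesis using n t by (simp add: field_simps)
  qed
  finally have "emeasure M (space M - A) \<le> ennreal (5 * L * r * sqrt (v * ln P / n) / t)"
    by (simp add: A_def set_diff_eq cong: conj_cong)
  then have "measure M (space M - A) \<le> 5 * L * r * sqrt (v * ln P / n) / t"
    using L r t v by (simp add: emeasure_eq_measure P_def)
  then have mA: "measure M A \<ge> 1 - 5 * L * r * sqrt (v * ln P / n) / t"
    by (simp add: prob_compl)
  have "(risk M p \<rho> X Y b - risk M p \<rho> X Y \<beta>)
        - (emp_risk n p \<rho> (\<lambda>i. Xs i \<omega>) (\<lambda>i. Ys i \<omega>) b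
           - emp_risk n p \<rho> (\<lambda>i. Xs i \<omega>) (\<lambda>i. Ys i \<omega>) \<beta>) \<le> t"
    if \<omega>: "\<omega> \<in> A" and b: "b \<in> rvec p" "l1norm_on {1..p} (vdiff p b \<beta>) \<le> r" for \<omega> b
  proof -
    let ?D = "\<lambda>b. (risk M p \<rho> X Y b - risk M p \<rho> X Y \<beta>)
        - (emp_risk n p \<rho> (\<lambda>i. Xs i \<omega>) (\<lambda>i. Ys i \<omega>) b
           - emp_risk n p \<rho> (\<lambda>i. Xs i \<omega>) (\<lambda>i. Ys i \<omega>) \<beta>)"
    have \<omega>M: "\<omega> \<in> space M" using \<omega> by (simp add: A_def)
    have nt: "real n * t > 0" using n t by simp
    have D_le: "?D b \<le> t" if "b \<in> T" for b
    proof -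
      let ?S = "\<Sum>i\<in>{1..n}. (\<integral>x. f b x \<partial>\<mu>) - f b (Z i \<omega>)"
      have "ennreal (1 / (n * t)) * ennreal ?S \<le> ennreal (1 / (n * t)) * V \<omega>"
        unfolding V_def using that by (intro mult_left_mono SUP_upper) auto
      also have "\<dots> < 1" using \<omega> by (simp add: A_def not_le)
      finally have "ennreal (1 / (n * t) * ?S) < 1"
        using nt ennreal_mult'[of "1 / (n * t)" ?S] by simp
      then have "\<not> 1 \<le> 1 / (n * t) * ?S"
        using ennreal_leI[of 1 "1 / (n * t) * ?S"] by (simp only: ennreal_1 not_le) auto
      then have "?S \<le> n * t"
        using nt by (simp add: field_simps)
      moreover have "?S = n * ?D b"
      proof -
        have "(\<integral>x. f b x \<partial>\<mu>) = risk M p \<rho> X Y b - risk M p \<rho> X Y \<beta>"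
          unfolding risk_eq f_def using \<l>_int by simp
        moreover have "(\<Sum>i\<in>{1..n}. f b (Z i \<omega>))
            = n * (emp_risk n p \<rho> (\<lambda>i. Xs i \<omega>) (\<lambda>i. Ys i \<omega>) b
               - emp_risk n p \<rho> (\<lambda>i. Xs i \<omega>) (\<lambda>i. Ys i \<omega>) \<beta>)"
          using n by (simp add: emp_risk_def f_def \<l>_def Z_def sum_subtractf right_diff_distrib)
        ultimately show ?thesis by (simp add: sum_subtractf right_diff_distrib)
      qed
      ultimately show ?thesis using n by simp
    qed
    \<comment> \<open>The set where the bound holds is closed and contains \<open>T\<close>, hence
      contains the ball.\<close>
    have "continuous_on UNIV ?D"
      by (intro continuous_intros risk_cont continuous_on_emp_risk[OF lip L Ys]) (use \<omega>M in auto)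
    then have "closed {b. ?D b \<le> t}" by (intro closed_Collect_le) auto
    then have "closure T \<subseteq> {b. ?D b \<le> t}" using D_le by (intro closure_minimal) auto
    then show ?thesis using b T by (auto simp: K_def)
  qed
  then show ?thesis using that[of A] mA unfolding P_def by simp
qed

section \<open>Localization of Lasso minimizers by convexity\<close>

text \<open>Tychonoff's theorem: the coordinates outside \<open>{1..p}\<close> are pinned to
  \<open>undefined\<close>, as extensionality demands, and the others lie in intervals of radius
  \<open>r\<close>. The ball is a closed subset of this compact box.\<close>

lemma compact_l1_ball:
  assumes "c \<in> rvec p"
  shows "compact {b \<in> rvec p. l1norm_on {1..p} (vdiff p b c) \<le> r}"
proof -
  let ?box = "PiE UNIV (\<lambda>j. if j \<in> {1..p} then {c j - r..c j + r} else {undefined})"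
  have "compactin (product_topology (\<lambda>_. euclidean) UNIV) ?box"
    unfolding compactin_PiE by auto
  then have box: "compact ?box" by (simp add: euclidean_product_topology)
  have cont: "continuous_on UNIV (\<lambda>b. \<Sum>j\<in>{1..p}. \<bar>b j - c j\<bar>)"
    by (intro continuous_intros) auto
  have "closed {b. (\<Sum>j\<in>{1..p}. \<bar>b j - c j\<bar>) \<le> r}"
    by (intro closed_Collect_le cont) auto
  then have "compact (?box \<inter> {b. (\<Sum>j\<in>{1..p}. \<bar>b j - c j\<bar>) \<le> r})"
    using box by (intro compact_Int_closed)
  also have "?box \<inter> {b. (\<Sum>j\<in>{1..p}. \<bar>b j - c j\<bar>) \<le> r} = {b \<in> rvec p. l1norm_on {1..p} (vdiff p b c) \<le> r}"
  proof -
    have "b j \<in> {c j - r..c j + r}" if "(\<Sum>j\<in>{1..p}. \<bar>b j - c j\<bar>) \<le> r" "j \<in> {1..p}" for b j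
      using member_le_sum[of j "{1..p}" "\<lambda>j. \<bar>b j - c j\<bar>"] that by force
    then show ?thesis
      by (auto simp: rvec_def PiE_def extensional_def Pi_def l1norm_on_def vdiff_def split: if_splits)
  qed
  finally show ?thesis .
qed

definition segment_point :: "nat \<Rightarrow> (nat \<Rightarrow> real) \<Rightarrow> (nat \<Rightarrow> real) \<Rightarrow> real \<Rightarrow> nat \<Rightarrow> real" where
  "segment_point p c b u = (\<lambda>j\<in>{1..p}. (1 - u) * c j + u * b j)"

lemma lasso_objective_convex:
  assumes conv: "\<And>y. y \<in> {0, 1} \<Longrightarrow> convex_on UNIV (\<lambda>b. \<rho> b y)"
    and y: "\<And>i. i \<in> {1..n} \<Longrightarrow> y i \<in> {0, 1 :: nat}"
    and lam: "lam \<ge> 0" and u: "0 \<le> u" "u \<le> 1"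
  shows "lasso_objective n p \<rho> lam x y (segment_point p c b u)
      \<le> (1 - u) * lasso_objective n p \<rho> lam x y c + u * lasso_objective n p \<rho> lam x y b"
proof -
  have "\<rho> (dotp p (segment_point p c b u) (x i)) (y i)
      \<le> (1 - u) * \<rho> (dotp p c (x i)) (y i) + u * \<rho> (dotp p b (x i)) (y i)" if "i \<in> {1..n}" for i
  proof -
    have "dotp p (segment_point p c b u) (x i) = (1 - u) * dotp p c (x i) + u * dotp p b (x i)"
      by (simp add: dotp_def segment_point_def sum_distrib_left sum.distrib[symmetric] algebra_simps)
    then show ?thesis
      using convex_onD[OF conv[OF y[OF that]] u, of "dotp p c (x i)" "dotp p b (x i)"] by simp
  qed
  then have "(\<Sum>i\<in>{1..n}. \<rho> (dotp p (segment_point p c b u) (x i)) (y i))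
      \<le> (\<Sum>i\<in>{1..n}. (1 - u) * \<rho> (dotp p c (x i)) (y i) + u * \<rho> (dotp p b (x i)) (y i))"
    by (rule sum_mono)
  then have "emp_risk n p \<rho> x y (segment_point p c b u)
      \<le> 1 / real n * (\<Sum>i\<in>{1..n}. (1 - u) * \<rho> (dotp p c (x i)) (y i) + u * \<rho> (dotp p b (x i)) (y i))"
    unfolding emp_risk_def by (intro mult_left_mono) auto
  also have "\<dots> = (1 - u) * emp_risk n p \<rho> x y c + u * emp_risk n p \<rho> x y b"
    by (simp add: emp_risk_def sum.distrib sum_distrib_left[symmetric] distrib_left)
  finally have 1: "emp_risk n p \<rho> x y (segment_point p c b u) \<le> \<dots>" .
  have "l1norm_on {1..p} (segment_point p c b u) \<le> (\<Sum>j\<in>{1..p}. (1 - u) * \<bar>c j\<bar> + u * \<bar>b j\<bar>)"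
    unfolding l1norm_on_def
  proof (rule sum_mono)
    fix j assume "j \<in> {1..p}"
    then show "\<bar>segment_point p c b u j\<bar> \<le> (1 - u) * \<bar>c j\<bar> + u * \<bar>b j\<bar>"
      using abs_triangle_ineq[of "(1 - u) * c j" "u * b j"] u by (simp add: segment_point_def abs_mult)
  qed
  also have "\<dots> = (1 - u) * l1norm_on {1..p} c + u * l1norm_on {1..p} b"
    by (simp add: l1norm_on_def sum.distrib sum_distrib_left)
  finally have "lam * l1norm_on {1..p} (segment_point p c b u)
      \<le> lam * ((1 - u) * l1norm_on {1..p} c + u * l1norm_on {1..p} b)"
    using lam by (intro mult_left_mono)
  with 1 show ?thesis by (simp add: lasso_objective_def algebra_simps)
qed

text \<open>By convexity, positivity of the increment on a sphere around \<open>c\<close> propagates to its exterior,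
  so compactness of the ball also yields the existence of a minimizer.\<close>

lemma lasso_localization:
  assumes conv: "\<And>y. y \<in> {0, 1} \<Longrightarrow> convex_on UNIV (\<lambda>b. \<rho> b y)"
    and lip: "\<And>b1 b2 y. y \<in> {0, 1} \<Longrightarrow> \<bar>\<rho> b1 y - \<rho> b2 y\<bar> \<le> L * \<bar>b1 - b2\<bar>" and L: "L > 0"
    and y: "\<And>i. i \<in> {1..n} \<Longrightarrow> y i \<in> {0, 1 :: nat}"
    and lam: "lam \<ge> 0" and r: "r > 0" and c: "c \<in> rvec p"
    and sphere: "\<And>b. b \<in> rvec p \<Longrightarrow> l1norm_on {1..p} (vdiff p b c) = r \<Longrightarrow>
      lasso_objective n p \<rho> lam x y c < lasso_objective n p \<rho> lam x y b"
  shows "\<exists>b. is_arg_min (lasso_objective n p \<rho> lam x y) (\<lambda>b. b \<in> rvec p) b"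
    and "is_arg_min (lasso_objective n p \<rho> lam x y) (\<lambda>b. b \<in> rvec p) b \<Longrightarrow>
      l1norm_on {1..p} (vdiff p b c) < r"
proof -
  let ?G = "lasso_objective n p \<rho> lam x y"
  let ?N = "\<lambda>b. l1norm_on {1..p} (vdiff p b c)"
  have outside: "?G c < ?G b" if b: "b \<in> rvec p" "?N b \<ge> r" for b
  proof -
    \<comment> \<open>The fraction of the segment from \<open>c\<close> to \<open>b\<close> at which
      it crosses the sphere.\<close>
    define u where "u = r / ?N b"
    have u: "0 < u" "u \<le> 1" using b r by (auto simp: u_def)
    have "?N (segment_point p c b u) = (\<Sum>j\<in>{1..p}. \<bar>u * (b j - c j)\<bar>)"
      unfolding l1norm_on_def by (intro sum.cong) (auto simp: segment_point_def vdiff_def algebra_simps)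
    also have "\<dots> = u * ?N b"
      using u by (simp add: abs_mult l1norm_on_def vdiff_def sum_distrib_left)
    also have "\<dots> = r" using b r by (simp add: u_def)
    finally have "?G c < ?G (segment_point p c b u)"
      by (intro sphere) (auto simp: segment_point_def rvec_def)
    also have "\<dots> \<le> (1 - u) * ?G c + u * ?G b"
      using u by (intro lasso_objective_convex[OF conv y lam]) auto
    finally have "u * ?G c < u * ?G b" by (simp add: algebra_simps)
    then show ?thesis using u by simp
  qed
  let ?K = "{b \<in> rvec p. ?N b \<le> r}"
  have "continuous_on UNIV (\<lambda>b. lam * l1norm_on {1..p} b)"
    unfolding l1norm_on_def by (intro continuous_intros) auto
  then have "continuous_on UNIV ?G"
    unfolding lasso_objective_def
    by (intro continuous_on_add continuous_on_emp_risk[OF lip L y]) auto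
  then have "continuous_on ?K ?G" by (rule continuous_on_subset) auto
  moreover have cK: "c \<in> ?K" using c r by (simp add: l1norm_on_def vdiff_def)
  ultimately obtain m where m: "m \<in> ?K" "\<And>b. b \<in> ?K \<Longrightarrow> ?G m \<le> ?G b"
    using continuous_attains_inf[OF compact_l1_ball[OF c, of r], of ?G] by blast
  have "?G m \<le> ?G b" if b: "b \<in> rvec p" for b
  proof (cases "?N b \<le> r")
    case False
    then have "?G c < ?G b" using outside b by simp
    then show ?thesis using m(2)[OF cK] by simp
  qed (use m b in auto)
  then have "is_arg_min ?G (\<lambda>b. b \<in> rvec p) m"
    using m by (simp add: is_arg_min_linorder)
  then show "\<exists>b. is_arg_min ?G (\<lambda>b. b \<in> rvec p) b" by blast
  assume "is_arg_min ?G (\<lambda>b. b \<in> rvec p) b"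
  then have "b \<in> rvec p" "?G b \<le> ?G c" using c by (auto simp: is_arg_min_linorder)
  then show "?N b < r" using outside[of b] by force
qed

section \<open>Positivity of the objective's increment on the sphere\<close>

lemma l1norm_on_split:
  assumes "S \<subseteq> {1..p}"
  shows "l1norm_on {1..p} v = l1norm_on S v + l1norm_on ({1..p} - S) v"
  unfolding l1norm_on_def using assms
  by (metis finite_atLeastAtMost sum.subset_diff add.commute)

text \<open>Off the support \<open>c\<close> vanishes, so the difference there is \<open>b\<close>
  itself; on the support the triangle inequality applies.\<close>

lemma l1norm_increment_ge:
  "l1norm_on ({1..p} - supp p c) (vdiff p b c) - l1norm_on (supp p c) (vdiff p b c)
     \<le> l1norm_on {1..p} b - l1norm_on {1..p} c"
proof -
  let ?S = "supp p c"
  have S: "?S \<subseteq> {1..p}" by (auto simp: supp_def)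
  have "l1norm_on ({1..p} - ?S) (vdiff p b c) = l1norm_on ({1..p} - ?S) b"
    and "l1norm_on ({1..p} - ?S) c = 0"
    unfolding l1norm_on_def by (auto simp: supp_def vdiff_def intro!: sum.cong)
  moreover have "l1norm_on ?S c \<le> l1norm_on ?S b + l1norm_on ?S (vdiff p b c)"
    unfolding l1norm_on_def sum.distrib[symmetric]
    by (intro sum_mono) (auto simp: supp_def vdiff_def)
  ultimately show ?thesis using l1norm_on_split[OF S] by simp
qed

text \<open>If the claim fails, the penalty bounds the off-support part of the difference by the
  on-support part \<open>a\<close>, so \<open>r \<le> (4 + \<epsilon>) * a\<close>. Cauchy-Schwarz
  over the support bounds the square of \<open>a\<close> by \<open>card S * q\<close>, while
  curvature forces \<open>\<theta> * d * q \<le> 3 * lam * r\<close>. Eliminating \<open>q\<close>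
  bounds \<open>r\<close> by a multiple of \<open>card S * lam\<close>, against
  \<open>large\<close>.\<close>

lemma sphere_increment_pos:
  fixes R E :: "(nat \<Rightarrow> real) \<Rightarrow> real" and p :: nat and c :: "nat \<Rightarrow> real"
    and lam r \<epsilon> \<delta> \<theta> d :: real
  defines "S \<equiv> supp p c"
  assumes b: "b \<in> rvec p" and r: "l1norm_on {1..p} (vdiff p b c) = r" "r > 0" "r \<le> \<delta>"
    and pos: "lam > 0" "\<epsilon> > 0" "\<theta> > 0" "d > 0"
    and min: "R c \<le> R b"
    and margin: "vdiff p b c \<in> cone_eps p S \<epsilon> \<inter> l1ball p \<delta> \<Longrightarrow>
      R b - R c \<ge> \<theta> / 2 * quad_form p H (vdiff p b c)"
    and kappa: "kappa p S H \<epsilon> > ereal d"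
    and dev: "(R b - R c) - (E b - E c) \<le> lam * r / 2"
    and large: "3 * (4 + \<epsilon>)\<^sup>2 * (card S * lam) < \<theta> * d * r"
  shows "E c + lam * l1norm_on {1..p} c < E b + lam * l1norm_on {1..p} b"
proof (rule ccontr)
  assume neg: "\<not> ?thesis"
  let ?\<Delta> = "vdiff p b c"
  define a where "a = l1norm_on S ?\<Delta>"
  define o' where "o' = l1norm_on ({1..p} - S) ?\<Delta>"
  define q where "q = dotp p ?\<Delta> ?\<Delta>"
  have S: "S \<subseteq> {1..p}" by (auto simp: S_def supp_def)
  have \<Delta>: "?\<Delta> \<in> rvec p" by (simp add: vdiff_def rvec_def)
  have ao: "a + o' = r" using l1norm_on_split[OF S, of ?\<Delta>] r by (simp add: a_def o'_def)
  have "lam * (o' - a) \<le> lam * (l1norm_on {1..p} b - l1norm_on {1..p} c)"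
    using l1norm_increment_ge[of p c b] pos unfolding a_def o'_def S_def by simp
  then have basic: "(R b - R c) + lam * (o' - a) \<le> lam * r / 2"
    using neg dev by (simp add: right_diff_distrib)
  then have "lam * (o' - a) \<le> lam * (r / 2)" using min by simp
  then have "o' - a \<le> r / 2" using pos by simp
  \<comment> \<open>Since \<open>r = a + o'\<close>, the slack \<open>r / 2\<close> is exactly what
    yields the factor 3.\<close>
  then have "o' \<le> 3 * a" using ao by simp
  moreover have "a \<ge> 0" by (simp add: a_def l1norm_on_def sum_nonneg)
  ultimately have cone: "o' \<le> (3 + \<epsilon>) * a" using pos by (simp add: distrib_right add_increasing2)
  then have in_cone: "?\<Delta> \<in> cone_eps p S \<epsilon>" using \<Delta> by (simp add: cone_eps_def a_def o'_def)
  have r_le: "r \<le> (4 + \<epsilon>) * a" using ao cone by (simp add: algebra_simps)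
  have "?\<Delta> \<noteq> vzero p"
    using r by (auto simp: vzero_def l1norm_on_def)
  then have "kappa p S H \<epsilon> \<le> ereal (quad_form p H ?\<Delta> / q)"
    unfolding kappa_def q_def using in_cone by (intro INF_lower) auto
  then have "ereal d < ereal (quad_form p H ?\<Delta> / q)" using kappa by (rule less_le_trans[rotated])
  then have dq: "d < quad_form p H ?\<Delta> / q" by simp
  have "a\<^sup>2 \<le> (\<Sum>j\<in>S. \<bar>?\<Delta> j\<bar>\<^sup>2) * card S"
    unfolding a_def l1norm_on_def by (rule sum_squared_le_sum_of_squares)
  also have "(\<Sum>j\<in>S. \<bar>?\<Delta> j\<bar>\<^sup>2) \<le> (\<Sum>j\<in>{1..p}. \<bar>?\<Delta> j\<bar>\<^sup>2)"
    using S by (intro sum_mono2) auto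
  also have "\<dots> = q" by (simp add: q_def dotp_def power2_eq_square)
  finally have aq: "a\<^sup>2 \<le> q * card S" by (simp add: mult_right_mono)
  have "q \<ge> 0" by (simp add: q_def dotp_def sum_nonneg)
  \<comment> \<open>Division by 0 gives 0, so \<open>q = 0\<close> would make \<open>dq\<close> read
    \<open>d < 0\<close>.\<close>
  moreover have "q \<noteq> 0" using dq pos by auto
  ultimately have q: "q > 0" by simp
  have "R b - R c \<ge> \<theta> / 2 * quad_form p H ?\<Delta>"
    using \<Delta> r in_cone by (intro margin) (simp add: l1ball_def)
  moreover have "\<theta> / 2 * quad_form p H ?\<Delta> \<ge> \<theta> / 2 * (d * q)"
    using dq q pos by (intro mult_left_mono) (auto simp: field_simps)
  moreover have "lam * (a - o') \<le> lam * r"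
    using ao pos by (intro mult_left_mono) (auto simp: o'_def l1norm_on_def sum_nonneg)
  \<comment> \<open>The 3 is \<open>2 * (1 / 2 + 1)\<close>: the deviation costs
    \<open>lam * r / 2\<close>, the penalty at most \<open>lam * r\<close>, and the 2 clears
    \<open>\<theta> / 2\<close>.\<close>
  ultimately have "\<theta> * d * q \<le> 3 * (lam * r)" using basic by (simp add: algebra_simps)
  then have "(\<theta> * d * q) * ((4 + \<epsilon>)\<^sup>2 * card S) \<le> (3 * (lam * r)) * ((4 + \<epsilon>)\<^sup>2 * card S)"
    by (intro mult_right_mono) auto
  also have "\<dots> = r * (3 * (4 + \<epsilon>)\<^sup>2 * (card S * lam))" by simp
  also have "\<dots> < r * (\<theta> * d * r)" using large r by (intro mult_strict_left_mono) auto
  also have "\<dots> = \<theta> * d * r\<^sup>2" by (simp add: power2_eq_square)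
  also have "\<dots> \<le> \<theta> * d * ((4 + \<epsilon>)\<^sup>2 * (q * card S))"
  proof (intro mult_left_mono)
    have "r\<^sup>2 \<le> ((4 + \<epsilon>) * a)\<^sup>2" using r r_le by (intro power_mono) auto
    also have "\<dots> = (4 + \<epsilon>)\<^sup>2 * a\<^sup>2" by (simp add: power_mult_distrib)
    also have "\<dots> \<le> (4 + \<epsilon>)\<^sup>2 * (q * card S)" using aq by (intro mult_left_mono) auto
    finally show "r\<^sup>2 \<le> (4 + \<epsilon>)\<^sup>2 * (q * card S)" .
  qed (use pos in auto)
  finally show False by (simp add: mult_ac)
qed

section \<open>Asymptotics: choice of radius and constants\<close>

theorem corollary1:
  fixes M :: "nat \<Rightarrow> 'a measure"
    and p :: "nat \<Rightarrow> nat"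
    and X :: "nat \<Rightarrow> 'a \<Rightarrow> nat \<Rightarrow> real"
    and Y :: "nat \<Rightarrow> 'a \<Rightarrow> nat"
    and Xs :: "nat \<Rightarrow> nat \<Rightarrow> 'a \<Rightarrow> nat \<Rightarrow> real"
    and Ys :: "nat \<Rightarrow> nat \<Rightarrow> 'a \<Rightarrow> nat"
    and \<sigma> :: "nat \<Rightarrow> nat \<Rightarrow> real"
    and \<rho> :: "real \<Rightarrow> nat \<Rightarrow> real"
    and L \<epsilon> \<delta> \<theta> :: real
    and H :: "nat \<Rightarrow> nat \<Rightarrow> nat \<Rightarrow> real"
    and lam :: "nat \<Rightarrow> real"
    and \<beta> :: "nat \<Rightarrow> nat \<Rightarrow> real"
    and \<beta>L :: "nat \<Rightarrow> 'a \<Rightarrow> nat \<Rightarrow> real"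
  assumes prob: "\<And>n. n \<ge> 1 \<Longrightarrow> prob_space (M n)"
    and pair: "\<And>n. n \<ge> 1 \<Longrightarrow> (\<lambda>\<omega>. (X n \<omega>, Y n \<omega>)) \<in> M n \<rightarrow>\<^sub>M obs_space (p n)"
    and indep: "\<And>n. n \<ge> 1 \<Longrightarrow>
      prob_space.indep_vars (M n) (\<lambda>_. obs_space (p n)) (\<lambda>i \<omega>. (Xs n i \<omega>, Ys n i \<omega>)) {1..n}"
    and copies: "\<And>n i. n \<ge> 1 \<Longrightarrow> i \<in> {1..n} \<Longrightarrow>
      distr (M n) (obs_space (p n)) (\<lambda>\<omega>. (Xs n i \<omega>, Ys n i \<omega>)) =
      distr (M n) (obs_space (p n)) (\<lambda>\<omega>. (X n \<omega>, Y n \<omega>))"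
    and sigma_nonneg: "\<And>n j. n \<ge> 1 \<Longrightarrow> j \<in> {1..p n} \<Longrightarrow> 0 \<le> \<sigma> n j"
    and subg: "\<And>n i j. n \<ge> 1 \<Longrightarrow> i \<in> {1..n} \<Longrightarrow> j \<in> {1..p n} \<Longrightarrow>
      subgaussian (M n) (\<lambda>\<omega>. Xs n i \<omega> j) ((\<sigma> n j)\<^sup>2)"
    and limsup_s: "limsup (\<lambda>n. (SUP j\<in>{1..p n}. ereal (\<sigma> n j))\<^sup>2) < \<infinity>"
    and nondegenerate: "\<And>n v. n \<ge> 1 \<Longrightarrow> v \<in> rvec (p n) \<Longrightarrow> v \<noteq> vzero (p n) \<Longrightarrow>
      \<not> (\<exists>c. AE \<omega> in M n. dotp (p n) v (X n \<omega>) = c)"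
    and rho_convex: "\<And>y. y \<in> {0, 1} \<Longrightarrow> convex_on UNIV (\<lambda>b. \<rho> b y)"
    and L_pos: "L > 0"
    and rho_lipschitz: "\<And>b1 b2 y. y \<in> {0, 1} \<Longrightarrow> \<bar>\<rho> b1 y - \<rho> b2 y\<bar> \<le> L * \<bar>b1 - b2\<bar>"
    and beta_argmin: "\<And>n. n \<ge> 1 \<Longrightarrow>
      is_arg_min (risk (M n) (p n) \<rho> (X n) (Y n)) (\<lambda>b. b \<in> rvec (p n)) (\<beta> n)"
    and beta_unique: "\<And>n b. n \<ge> 1 \<Longrightarrow>
      is_arg_min (risk (M n) (p n) \<rho> (X n) (Y n)) (\<lambda>b. b \<in> rvec (p n)) b \<Longrightarrow> b = \<beta> n"
    and eps_pos: "\<epsilon> > 0" and delta_pos: "\<delta> > 0" and theta_pos: "\<theta> > 0"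
    and H_nonneg: "\<And>n. n \<ge> 1 \<Longrightarrow> nonneg_definite (p n) (H n)"
    and margin: "\<And>n b. n \<ge> 1 \<Longrightarrow> b \<in> rvec (p n) \<Longrightarrow>
      vdiff (p n) b (\<beta> n) \<in> cone_eps (p n) (supp (p n) (\<beta> n)) \<epsilon> \<inter> l1ball (p n) \<delta> \<Longrightarrow>
      risk (M n) (p n) \<rho> (X n) (Y n) b - risk (M n) (p n) \<rho> (X n) (Y n) (\<beta> n)
        \<ge> \<theta> / 2 * quad_form (p n) (H n) (vdiff (p n) b (\<beta> n))"
    and lam_pos: "\<And>n. n \<ge> 1 \<Longrightarrow> lam n > 0"
    and lam_bound: "\<And>n. n \<ge> 1 \<Longrightarrow>
      ereal (2 * real (card (supp (p n) (\<beta> n))) * lam n)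
          / (ereal \<theta> * kappa (p n) (supp (p n) (\<beta> n)) (H n) \<epsilon>)
        \<le> ereal (2 / (4 + \<epsilon>)) * min (beta_min (p n) (\<beta> n) / 2) (ereal \<delta>)"
    and log_p: "(\<lambda>n. ln (real (max (p n) 2))) \<in> o(\<lambda>n. (lam n)\<^sup>2 * real n)"
    and kappa_lower: "\<exists>d::real. d > 0 \<and>
      (\<forall>\<^sub>F n in sequentially. kappa (p n) (supp (p n) (\<beta> n)) (H n) \<epsilon> > ereal d)"
    and s_lam: "(\<lambda>n. real (card (supp (p n) (\<beta> n))) * lam n)
      \<in> o(\<lambda>n. real_of_ereal (min (beta_min (p n) (\<beta> n)) 1))"
    and lasso_rv: "\<And>n. n \<ge> 1 \<Longrightarrow> \<beta>L n \<in> M n \<rightarrow>\<^sub>M PiM {1..p n} (\<lambda>_. borel)"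
    and lasso: "\<And>n \<omega>. n \<ge> 1 \<Longrightarrow> \<omega> \<in> space (M n) \<Longrightarrow>
      \<exists>b. is_arg_min (lasso_objective n (p n) \<rho> (lam n) (\<lambda>i. Xs n i \<omega>) (\<lambda>i. Ys n i \<omega>))
            (\<lambda>b. b \<in> rvec (p n)) b \<Longrightarrow>
      is_arg_min (lasso_objective n (p n) \<rho> (lam n) (\<lambda>i. Xs n i \<omega>) (\<lambda>i. Ys n i \<omega>))
        (\<lambda>b. b \<in> rvec (p n)) (\<beta>L n \<omega>)"
  shows "((\<lambda>n. measure (M n) {\<omega> \<in> space (M n).
            ereal (l1norm_on {1..p n} (vdiff (p n) (\<beta>L n \<omega>) (\<beta> n)))
              \<le> beta_min (p n) (\<beta> n) / 2}) \<longlonglongrightarrow> 1)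
    \<and> ((\<lambda>n. measure (M n) {\<omega> \<in> space (M n).
            (SUP i\<in>{1..p n} - supp (p n) (\<beta> n). ereal \<bar>\<beta>L n \<omega> i\<bar>)
              \<le> (INF i\<in>supp (p n) (\<beta> n). ereal \<bar>\<beta>L n \<omega> i\<bar>)}) \<longlonglongrightarrow> 1)"
proof -
  define m where "m = (\<lambda>n. real_of_ereal (beta_min (p n) (\<beta> n)))"
  define P where "P = (\<lambda>n. real (max (p n) 2))"
  let ?s = "\<lambda>n. real (card (supp (p n) (\<beta> n)))"
  let ?E1 = "\<lambda>n. {\<omega> \<in> space (M n). ereal (l1norm_on {1..p n} (vdiff (p n) (\<beta>L n \<omega>) (\<beta> n)))
              \<le> beta_min (p n) (\<beta> n) / 2}"
  let ?E2 = "\<lambda>n. {\<omega> \<in> space (M n). (SUP i\<in>{1..p n} - supp (p n) (\<beta> n). ereal \<bar>\<beta>L n \<omega> i\<bar>)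
              \<le> (INF i\<in>supp (p n) (\<beta> n). ereal \<bar>\<beta>L n \<omega> i\<bar>)}"
  have \<beta>: "\<beta> n \<in> rvec (p n)" if "n \<ge> 1" for n
    using beta_argmin[OF that] by (simp add: is_arg_min_def)
  have \<beta>_le: "risk (M n) (p n) \<rho> (X n) (Y n) (\<beta> n) \<le> risk (M n) (p n) \<rho> (X n) (Y n) b"
    if "n \<ge> 1" "b \<in> rvec (p n)" for n b
    using beta_argmin[OF that(1)] that(2) by (simp add: is_arg_min_linorder)
  have beta_min_real: "beta_min (p n) (\<beta> n) = ereal (m n) \<and> m n > 0
      \<and> (\<forall>i\<in>supp (p n) (\<beta> n). m n \<le> \<bar>\<beta> n i\<bar>)"
    if "supp (p n) (\<beta> n) \<noteq> {}" for n
  proof -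
    have fin: "finite (supp (p n) (\<beta> n))" by (simp add: supp_def)
    have eq: "beta_min (p n) (\<beta> n) = ereal (Min ((\<lambda>i. \<bar>\<beta> n i\<bar>) ` supp (p n) (\<beta> n)))" (is "_ = ereal ?m")
    proof (rule antisym)
      have "?m \<in> (\<lambda>i. \<bar>\<beta> n i\<bar>) ` supp (p n) (\<beta> n)" using fin that by (intro Min_in) auto
      then show "beta_min (p n) (\<beta> n) \<le> ereal ?m" unfolding beta_min_def by (auto intro: INF_lower)
      show "ereal ?m \<le> beta_min (p n) (\<beta> n)"
        unfolding beta_min_def using fin by (intro INF_greatest) auto
    qed
    then have "m n = ?m" by (simp add: m_def)
    then show ?thesis using eq fin that by (auto simp: supp_def)
  qed
  \<comment> \<open>Comparing probabilities by inclusion needs the larger event measurable, as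
    \<open>measure\<close> of a non-measurable set is 0.\<close>
  have E1_meas: "?E1 n \<in> sets (M n)" and E2_meas: "?E2 n \<in> sets (M n)" if n: "n \<ge> 1" for n
  proof -
    have [measurable]: "(\<lambda>\<omega>. \<beta>L n \<omega> i) \<in> borel_measurable (M n)" if "i \<in> {1..p n}" for i
      using lasso_rv[OF n] that by (rule measurable_compose[OF _ measurable_component_singleton])
    have [measurable]: "(\<lambda>\<omega>. l1norm_on {1..p n} (vdiff (p n) (\<beta>L n \<omega>) (\<beta> n))) \<in> borel_measurable (M n)"
      unfolding l1norm_on_def by (intro borel_measurable_sum) (simp add: vdiff_def)
    show "?E1 n \<in> sets (M n)" by measurable
    have [measurable]: "(\<lambda>\<omega>. SUP i\<in>{1..p n} - supp (p n) (\<beta> n). ereal \<bar>\<beta>L n \<omega> i\<bar>) \<in> borel_measurable (M n)"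
      "(\<lambda>\<omega>. INF i\<in>supp (p n) (\<beta> n). ereal \<bar>\<beta>L n \<omega> i\<bar>) \<in> borel_measurable (M n)"
      by (auto intro!: borel_measurable_SUP borel_measurable_INF borel_measurable_ereal borel_measurable_abs
          countable_finite simp: supp_def)
    show "?E2 n \<in> sets (M n)" by measurable
  qed
  \<comment> \<open>The separation is deterministic: errors at an off-support and an on-support
    coordinate together use at most half of the smallest true coefficient. For an empty support the
    infimum is infinite.\<close>
  have E12: "?E1 n \<subseteq> ?E2 n" for n
  proof (cases "supp (p n) (\<beta> n) = {}")
    case False
    note m = beta_min_real[OF False]
    have "\<bar>\<beta>L n \<omega> k\<bar> \<le> \<bar>\<beta>L n \<omega> i\<bar>"
      if \<omega>: "\<omega> \<in> ?E1 n" and k: "k \<in> {1..p n} - supp (p n) (\<beta> n)" and i: "i \<in> supp (p n) (\<beta> n)" for \<omega> k i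
    proof -
      have ki: "{k, i} \<subseteq> {1..p n}" "k \<noteq> i" "\<beta> n k = 0" using k i by (auto simp: supp_def)
      have "(\<Sum>j\<in>{k, i}. \<bar>vdiff (p n) (\<beta>L n \<omega>) (\<beta> n) j\<bar>) \<le> l1norm_on {1..p n} (vdiff (p n) (\<beta>L n \<omega>) (\<beta> n))"
        unfolding l1norm_on_def using ki by (intro sum_mono2) auto
      also have "\<dots> \<le> m n / 2" using \<omega> m by simp
      finally have "\<bar>\<beta>L n \<omega> k\<bar> + \<bar>\<beta>L n \<omega> i - \<beta> n i\<bar> \<le> m n / 2"
        using ki by (simp add: vdiff_def)
      moreover have "m n \<le> \<bar>\<beta> n i\<bar>" using m i by blast
      ultimately show ?thesis by linarith
    qed
    then show ?thesis by (auto intro!: SUP_least INF_greatest)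
  qed auto
  obtain d where d: "d > 0"
    "\<forall>\<^sub>F n in sequentially. kappa (p n) (supp (p n) (\<beta> n)) (H n) \<epsilon> > ereal d"
    using kappa_lower by blast
  obtain v :: nat where v0: "limsup (\<lambda>n. (SUP j\<in>{1..p n}. ereal (\<sigma> n j))\<^sup>2) < ereal (real v)"
    using limsup_s less_PInf_Ex_of_nat by (metis less_irrefl)
  define V where "V = real v + 1"
  have V: "V > 0" by (simp add: V_def)
  have ev_V: "\<forall>\<^sub>F n in sequentially. \<forall>j\<in>{1..p n}. (\<sigma> n j)\<^sup>2 \<le> V"
    using Limsup_lessD[OF v0] eventually_ge_at_top[of 1]
  proof eventually_elim
    case (elim n)
    have "(\<sigma> n j)\<^sup>2 \<le> V" if j: "j \<in> {1..p n}" for j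
    proof -
      have "0 \<le> ereal (\<sigma> n j)" using sigma_nonneg[OF elim(2) j] by simp
      moreover have "ereal (\<sigma> n j) \<le> (SUP j\<in>{1..p n}. ereal (\<sigma> n j))" using j by (intro SUP_upper)
      ultimately have "ereal (\<sigma> n j) * ereal (\<sigma> n j)
          \<le> (SUP j\<in>{1..p n}. ereal (\<sigma> n j)) * (SUP j\<in>{1..p n}. ereal (\<sigma> n j))"
        by (intro ereal_mult_mono) (auto intro: order_trans simp only:)
      also have "\<dots> < ereal (real v)" using elim(1) by (simp add: power2_eq_square)
      finally show ?thesis by (simp add: V_def power2_eq_square)
    qed
    then show ?case by blast
  qed
  \<comment> \<open>Chosen so that \<open>3 * (4 + \<epsilon>)\<^sup>2 * c\<close> times
    \<open>min (m n) 1\<close> is half of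
    \<open>\<theta> * d * min (1 / 2) \<delta> * min (m n) 1\<close>, which is at most
    \<open>\<theta> * d * r\<close>; the half makes the inequality strict.\<close>
  define c where "c = \<theta> * d * min (1 / 2) \<delta> / (3 * (4 + \<epsilon>)\<^sup>2) / 2"
  have c: "c > 0" using eps_pos delta_pos theta_pos d by (simp add: c_def)
  have ev_s: "\<forall>\<^sub>F n in sequentially. norm (?s n * lam n)
      \<le> c * norm (real_of_ereal (min (beta_min (p n) (\<beta> n)) 1))"
    using landau_o.smallD[OF s_lam c] .
  \<comment> \<open>The deviation bound at \<open>t = lam n * r / 2\<close>: \<open>r\<close>
    cancels and \<open>5\<close> becomes \<open>10\<close>.\<close>
  define l where "l = (\<lambda>n. 1 - 10 * L * sqrt (V * (ln (P n) / ((lam n)\<^sup>2 * real n))))"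
  have main: "\<forall>\<^sub>F n in sequentially. l n \<le> measure (M n) (?E1 n)"
    using d(2) ev_V ev_s eventually_ge_at_top[of 1]
  proof eventually_elim
    case (elim n)
    interpret prob_space "M n" by (rule prob[OF elim(4)])
    show ?case
    proof (cases "supp (p n) (\<beta> n) = {}")
      case True
      then have "?E1 n = space (M n)" by (simp add: beta_min_def top_ereal_def)
      moreover have "l n \<le> 1" using L_pos V by (simp add: l_def P_def)
      ultimately show ?thesis by (simp add: prob_space)
    next
      case False
      note m = beta_min_real[OF False]
      define r where "r = min (m n / 2) \<delta>"
      have r: "r > 0" "r \<le> \<delta>" "r \<le> m n / 2" using m delta_pos by (auto simp: r_def)
      have lam: "lam n > 0" using lam_pos elim(4) by simp
      have "?s n * lam n \<le> c * min (m n) 1"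
        using elim(3) m lam by (simp add: min_def split: if_splits)
      then have "3 * (4 + \<epsilon>)\<^sup>2 * (?s n * lam n) \<le> 3 * (4 + \<epsilon>)\<^sup>2 * (c * min (m n) 1)"
        by (intro mult_left_mono) auto
      also have "\<dots> = \<theta> * d * (min (1 / 2) \<delta> * min (m n) 1) / 2"
        using eps_pos by (simp add: c_def)
      also have "\<dots> < \<theta> * d * (min (1 / 2) \<delta> * min (m n) 1)"
        using theta_pos d delta_pos m by simp
      also have "\<dots> \<le> \<theta> * d * r"
      proof (intro mult_left_mono)
        have "min (1 / 2) \<delta> * min (m n) 1 \<le> 1 / 2 * m n" "min (1 / 2) \<delta> * min (m n) 1 \<le> \<delta> * 1"
          using delta_pos m by (intro mult_mono; simp)+
        then show "min (1 / 2) \<delta> * min (m n) 1 \<le> r" by (simp add: r_def)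
      qed (use theta_pos d in auto)
      finally have large: "3 * (4 + \<epsilon>)\<^sup>2 * (?s n * lam n) < \<theta> * d * r" .
      have t: "lam n * r / 2 > 0" using lam r by simp
      have subgV: "subgaussian (M n) (\<lambda>\<omega>. Xs n i \<omega> j) V" if "i \<in> {1..n}" "j \<in> {1..p n}" for i j
        using subgaussian_mono[OF subg[OF elim(4) that]] elim(2) that by blast
      obtain A where A: "A \<in> sets (M n)"
        "prob A \<ge> 1 - 5 * L * r * sqrt (V * ln (real (max (p n) 2)) / real n) / (lam n * r / 2)"
        "\<And>\<omega> b. \<omega> \<in> A \<Longrightarrow> b \<in> rvec (p n) \<Longrightarrow> l1norm_on {1..p n} (vdiff (p n) b (\<beta> n)) \<le> r \<Longrightarrow>
          (risk (M n) (p n) \<rho> (X n) (Y n) b - risk (M n) (p n) \<rho> (X n) (Y n) (\<beta> n))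
            - (emp_risk n (p n) \<rho> (\<lambda>i. Xs n i \<omega>) (\<lambda>i. Ys n i \<omega>) b
               - emp_risk n (p n) \<rho> (\<lambda>i. Xs n i \<omega>) (\<lambda>i. Ys n i \<omega>) (\<beta> n)) \<le> lam n * r / 2"
        by (rule deviation_bound[OF prob[OF elim(4)] elim(4) pair[OF elim(4)] indep[OF elim(4)]
          copies[OF elim(4)] subgV V L_pos rho_lipschitz \<beta>[OF elim(4)] r(1) t]) blast+
      have "5 * L * r * sqrt (V * ln (real (max (p n) 2)) / real n) / (lam n * r / 2)
          = 10 * L * (sqrt (V * ln (P n) / real n) / sqrt ((lam n)\<^sup>2))"
        using r lam by (simp add: P_def field_simps)
      also have "sqrt (V * ln (P n) / real n) / sqrt ((lam n)\<^sup>2) = sqrt (V * ln (P n) / real n / (lam n)\<^sup>2)"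
        by (simp only: real_sqrt_divide)
      also have "V * ln (P n) / real n / (lam n)\<^sup>2 = V * (ln (P n) / ((lam n)\<^sup>2 * real n))"
        by (simp add: field_simps)
      finally have "l n \<le> prob A" using A(2) by (simp add: l_def)
      also have "prob A \<le> prob (?E1 n)"
      proof (intro finite_measure_mono E1_meas[OF elim(4)] subsetI)
        fix \<omega> assume \<omega>: "\<omega> \<in> A"
        then have \<omega>M: "\<omega> \<in> space (M n)" using A(1) sets.sets_into_space by blast
        have y: "Ys n i \<omega> \<in> {0, 1}" if "i \<in> {1..n}" for i
        proof -
          have "(\<lambda>\<omega>. (Xs n i \<omega>, Ys n i \<omega>)) \<in> M n \<rightarrow>\<^sub>M obs_space (p n)"
            using indep[OF elim(4)] that unfolding indep_vars_def by blast
          from measurable_space[OF this \<omega>M] show ?thesis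
            by (auto simp: obs_space_def space_pair_measure)
        qed
        let ?G = "lasso_objective n (p n) \<rho> (lam n) (\<lambda>i. Xs n i \<omega>) (\<lambda>i. Ys n i \<omega>)"
        have sphere: "?G (\<beta> n) < ?G b"
          if b: "b \<in> rvec (p n)" "l1norm_on {1..p n} (vdiff (p n) b (\<beta> n)) = r" for b
          unfolding lasso_objective_def
          using b(2) A(3)[OF \<omega> b(1)]
          by (intro sphere_increment_pos[where R = "risk (M n) (p n) \<rho> (X n) (Y n)", OF b r(1,2) lam
            eps_pos theta_pos d(1) \<beta>_le[OF elim(4) b(1)] margin[OF elim(4) b(1)] elim(1) _ large]) auto
        \<comment> \<open>\<open>lasso\<close> constrains \<open>\<beta>L n \<omega>\<close> only
          where a minimizer exists, so existence on \<open>A\<close> has to be established before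
          the estimator can be located.\<close>
        have "\<exists>b. is_arg_min ?G (\<lambda>b. b \<in> rvec (p n)) b"
          by (rule lasso_localization(1)[OF rho_convex rho_lipschitz L_pos y less_imp_le[OF lam] r(1)
            \<beta>[OF elim(4)] sphere])
        then have "is_arg_min ?G (\<lambda>b. b \<in> rvec (p n)) (\<beta>L n \<omega>)"
          by (rule lasso[OF elim(4) \<omega>M])
        then have "l1norm_on {1..p n} (vdiff (p n) (\<beta>L n \<omega>) (\<beta> n)) < r"
          by (rule lasso_localization(2)[OF rho_convex rho_lipschitz L_pos y less_imp_le[OF lam] r(1)
            \<beta>[OF elim(4)] sphere, rotated -1])
        then show "\<omega> \<in> ?E1 n" using \<omega>M m r by simp
      qed
      finally show ?thesis .
    qed
  qed
  have l_lim: "l \<longlonglongrightarrow> 1"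
  proof -
    have "(\<lambda>n. ln (P n) / ((lam n)\<^sup>2 * real n)) \<longlonglongrightarrow> 0"
      using smalloD_tendsto[OF log_p] by (simp add: P_def)
    then have "l \<longlonglongrightarrow> 1 - 10 * L * sqrt (V * 0)"
      unfolding l_def by (intro tendsto_intros)
    then show ?thesis by simp
  qed
  have le1: "\<forall>\<^sub>F n in sequentially. measure (M n) (S n) \<le> 1" for S
    using eventually_ge_at_top[of 1] by eventually_elim (simp add: prob prob_space.prob_le_1)
  have E1: "(\<lambda>n. measure (M n) (?E1 n)) \<longlonglongrightarrow> 1"
    by (rule tendsto_sandwich[OF main le1 l_lim tendsto_const])
  have "\<forall>\<^sub>F n in sequentially. measure (M n) (?E1 n) \<le> measure (M n) (?E2 n)"
    using eventually_ge_at_top[of 1]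
  proof eventually_elim
    case (elim n)
    interpret prob_space "M n" by (rule prob[OF elim])
    show ?case by (intro finite_measure_mono E12 E2_meas elim)
  qed
  then have "(\<lambda>n. measure (M n) (?E2 n)) \<longlonglongrightarrow> 1"
    by (rule tendsto_sandwich[OF _ le1 E1 tendsto_const])
  with E1 show ?thesis by blast
qed

end
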